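(* Let $\nu>0$ and consider a sequence $\{\theta_k\}_{k \in \mathbb{N}}$, $\theta_k=(\mu_k,\Sigma_k)$, generated by the heavy-tail ML algorithm (defined in the context) with Student proposals $p_\theta=\mathcal{T}(\cdot;\mu,\Sigma,\nu)$. At every iteration $k \in \mathbb{N}$, we have the decrease $$KL(\pi_{\theta_k}^f, p_{\theta_{k+1}}) + \Delta_k \leq KL(\pi_{\theta_k}^f, p_{\theta_k}),$$ for some $\Delta_k > 0$, unless $\theta_{k+1} = \theta_k$, in which case $\Delta_k = 0$.
   Context: Setting: $\mathbb{X}=\mathbb{R}^d$, $m$ is the Lebesgue measure, and $f:\mathbb{R}^d\to\mathbb{R}$ is an objective function. Fix a degree of freedom parameter $\nu>0$. Let $\mathcal{S}_{++}^d$ be the set of $d \times d$ symmetric positive definite matrices and $\Theta=\mathbb{R}^d\times\mathcal{S}_{++}^d$. For $\theta=(\mu,\Sigma)\in\Theta$, the proposal $p_\theta=\mathcal{T}(\cdot;\mu,\Sigma,\nu)$ is the Student distribution with density with respect to the Lebesgue measure $$\mathcal{T}(x;\mu,\Sigma,\nu)\propto\left(1+\frac{1}{\nu}(x-\mu)^\top\Sigma^{-1}(x-\mu)\right)^{-\frac{\nu+d}{2}},\quad x\in\mathbb{R}^d.$$ For $\theta\in\Theta$ and $x\in\mathbb{X}$, set $q_\theta^{<}(x) = \mathbb{P}_{X\sim p_\theta}[f(X)<f(x)]$ and $q_\theta^{\leq}(x) = \mathbb{P}_{X\sim p_\theta}[f(X)\leq f(x)]$. Let $w:[0,1]\to\mathbb{R}_+$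 be non-increasing and $Z_w=\int_0^1 w(u)\,du$ (assumed positive so that the target density is defined). Define $W_\theta^f(x) = w(q_\theta^{\leq}(x))$ if $q_\theta^{\leq}(x)=q_\theta^{<}(x)$, and $W_\theta^f(x) = \frac{1}{q_\theta^{\leq}(x)-q_\theta^{<}(x)}\int_{q_\theta^{<}(x)}^{q_\theta^{\leq}(x)} w(u)\,du$ otherwise. The target density is $\pi_\theta^f(x)=\frac{1}{Z_w}W_\theta^f(x)p_\theta(x)$, which is a probability density. Divergence: for probability densities $p_1,p_2$, $KL(p_1,p_2)=\int \ln\left(\frac{p_1(x)}{p_2(x)}\right)p_1(x)\,dx$, with $\ln(p_1(x))p_1(x)=0$ when $p_1(x)=0$. Heavy-tail ML algorithm: initialize $\theta_0=(\mu_0,\Sigma_0)\in\Theta$. For $k=0,1,\dots$, define for $x\in\mathbb{R}^d$ $$\gamma_k^{(\nu)}(x)=\frac{\nu+d}{\nu+(x-\mu_k)^\top\Sigma_k^{-1}(x-\mu_k)},$$ and update $\theta_{k+1}=(\mu_{k+1},\Sigma_{k+1})$ by $$\mu_{k+1}=\frac{\mathbb{E}_{X\sim\pi_{\theta_k}^f}[\gamma_k^{(\nu)}(X)X]}{\mathbb{E}_{X\sim\pi_{\theta_k}^f}[\gamma_k^{(\nu)}(X)]},\qquad \Sigma_{k+1}=\frac{\mathbb{E}_{X\sim\pi_{\theta_k}^f}[\gamma_k^{(\nu)}(X)XX^\top]}{\mathbb{E}_{X\sim\pi_{\theta_k}^f}[\gamma_k^{(\nu)}(X)]}-\mu_{k+1}\mu_{k+1}^\top.$$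 *)

theory Defs
  imports "HOL-Probability.Probability"
begin

text \<open>
  The space is \<open>real ^ 'n\<close>, of dimension \<open>CARD('n)\<close>; a parameter is a pair of a location and a
  scale matrix.
\<close>

definition spd :: "real ^ 'n ^ 'n \<Rightarrow> bool" where
  "spd A \<longleftrightarrow> transpose A = A \<and> (\<forall>x. x \<noteq> 0 \<longrightarrow> 0 < x \<bullet> (A *v x))"

definition Params :: "((real ^ 'n) \<times> (real ^ 'n ^ 'n)) set" where
  "Params = {(\<mu>, S). spd S}"

definition mahalanobis :: "(real ^ 'n) \<times> (real ^ 'n ^ 'n) \<Rightarrow> real ^ 'n \<Rightarrow> real" where
  "mahalanobis \<theta> x = (x - fst \<theta>) \<bullet> (matrix_inv (snd \<theta>) *v (x - fst \<theta>))"

definition student_kernel ::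
  "real \<Rightarrow> (real ^ 'n) \<times> (real ^ 'n ^ 'n) \<Rightarrow> real ^ 'n \<Rightarrow> real" where
  "student_kernel \<nu> \<theta> x =
     (1 + (1 / \<nu>) * mahalanobis \<theta> x) powr (- ((\<nu> + real CARD('n)) / 2))"

definition student ::
  "real \<Rightarrow> (real ^ 'n) \<times> (real ^ 'n ^ 'n) \<Rightarrow> real ^ 'n \<Rightarrow> real" where
  "student \<nu> \<theta> x = student_kernel \<nu> \<theta> x / (\<integral>y. student_kernel \<nu> \<theta> y \<partial>lebesgue)"

definition law :: "(real ^ 'n \<Rightarrow> real) \<Rightarrow> (real ^ 'n) measure" where
  "law p = density lebesgue (\<lambda>x. ennreal (p x))"

definition q_less :: "(real ^ 'n \<Rightarrow> real) \<Rightarrow> (real ^ 'n \<Rightarrow> real) \<Rightarrow> real ^ 'n \<Rightarrow> real" where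
  "q_less f p x = measure (law p) {y. f y < f x}"

definition q_le :: "(real ^ 'n \<Rightarrow> real) \<Rightarrow> (real ^ 'n \<Rightarrow> real) \<Rightarrow> real ^ 'n \<Rightarrow> real" where
  "q_le f p x = measure (law p) {y. f y \<le> f x}"

text \<open>
  The weight function \<open>w\<close> has domain \<open>[0,1]\<close>; its values outside that interval are never used.
\<close>

definition weight ::
  "(real \<Rightarrow> real) \<Rightarrow> (real ^ 'n \<Rightarrow> real) \<Rightarrow> (real ^ 'n \<Rightarrow> real) \<Rightarrow> real ^ 'n \<Rightarrow> real" where
  "weight w f p x =
     (if q_le f p x = q_less f p x then w (q_le f p x)
      else (1 / (q_le f p x - q_less f p x)) * integral {q_less f p x..q_le f p x} w)"

definition target ::
  "(real \<Rightarrow> real) \<Rightarrow> (real ^ 'n \<Rightarrow> real) \<Rightarrow> (real ^ 'n \<Rightarrow> real) \<Rightarrow> real ^ 'n \<Rightarrow> real" where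
  "target w f p x = (1 / integral {0..1} w) * weight w f p x * p x"

text \<open>
  The divergence of two probability densities takes values in \<open>[0,\<infinity>]\<close>. It is the positive part
  minus the negative part of the integral, the latter being finite for probability densities, so
  that a divergent integral gives \<open>\<infinity>\<close> and not the default value of the Bochner integral.
  The integrand vanishes where \<open>p1\<close> does. The second density is meant to be positive everywhere,
  as Student densities are: where \<open>p2 x = 0\<close>, the integrand would be \<open>0\<close> and not \<open>\<infinity>\<close>.
\<close>

definition KL :: "(real ^ 'n \<Rightarrow> real) \<Rightarrow> (real ^ 'n \<Rightarrow> real) \<Rightarrow> ereal" where
  "KL p1 p2 =
     enn2ereal (\<integral>\<^sup>+x. ennreal (ln (p1 x / p2 x) * p1 x) \<partial>lebesgue)
     - enn2ereal (\<integral>\<^sup>+x. ennreal (- (ln (p1 x / p2 x) * p1 x)) \<partial>lebesgue)"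

definition gam :: "real \<Rightarrow> (real ^ 'n) \<times> (real ^ 'n ^ 'n) \<Rightarrow> real ^ 'n \<Rightarrow> real" where
  "gam \<nu> \<theta> x = (\<nu> + real CARD('n)) / (\<nu> + mahalanobis \<theta> x)"

definition outer :: "real ^ 'n \<Rightarrow> real ^ 'n ^ 'n" where
  "outer x = (\<chi> i j. x $ i * x $ j)"

definition ml_step ::
  "real \<Rightarrow> (real \<Rightarrow> real) \<Rightarrow> (real ^ 'n \<Rightarrow> real)
    \<Rightarrow> (real ^ 'n) \<times> (real ^ 'n ^ 'n) \<Rightarrow> (real ^ 'n) \<times> (real ^ 'n ^ 'n)" where
  "ml_step \<nu> w f \<theta> =
     (let P = law (target w f (student \<nu> \<theta>));
          g = (\<integral>x. gam \<nu> \<theta> x \<partial>P);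
          \<mu>' = (1 / g) *\<^sub>R (\<integral>x. gam \<nu> \<theta> x *\<^sub>R x \<partial>P);
          S' = (1 / g) *\<^sub>R (\<integral>x. gam \<nu> \<theta> x *\<^sub>R outer x \<partial>P) - outer \<mu>'
      in (\<mu>', S'))"

end

theory Submission
  imports Defs
begin

text \<open>
  Write \<open>g\<close> for the mean of \<open>\<gamma>\<close> under the normalised target, \<open>K\<close> for the inverse scale matrix of
  \<open>\<theta>\<close>, and \<open>a\<close>, \<open>a'\<close> for \<open>\<nu>\<close> plus the squared Mahalanobis distance under \<open>\<theta>\<close>, \<open>\<theta>'\<close>. Jensen's
  inequality for the logarithm, applied to \<open>a' / a\<close> whose mean is exactly \<open>g\<close>, shows that the
  divergence changes by at most half of \<open>ln (det S' / det S) + (\<nu> + d) ln g\<close>. The update gives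
  \<open>g (\<nu> + tr (K S') + \<delta>) = \<nu> + d\<close>, where \<open>\<delta> \<ge> 0\<close> is the squared Mahalanobis displacement of the
  location. Now \<open>ln (det C) \<le> tr C - d\<close> for \<open>C = g R S' R\<^sup>T\<close>, where \<open>K = R\<^sup>T R\<close>, and \<open>ln g \<le> g - 1\<close>
  bound the change by \<open>- g \<delta> / 2\<close>, and equality throughout forces \<open>g = 1\<close>, \<open>S' = S\<close> and \<open>\<delta> = 0\<close>.
  The mass \<open>m\<close> of the target only scales the estimate, so that \<open>m > 0\<close> suffices.
\<close>

section \<open>Positive definite matrices\<close>

text \<open>
  The Schur complement of the entry \<open>(i, i)\<close>, padded with the \<open>i\<close>-th unit row and column so that it
  keeps the size of \<open>K\<close>; \<open>K\<close> is recovered by completing the square in the coordinate \<open>i\<close>.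
\<close>

definition schur :: "'n \<Rightarrow> real ^ 'n ^ 'n \<Rightarrow> real ^ 'n ^ 'n" where
  "schur i K = (\<chi> j k. if j = i \<or> k = i then of_bool (j = k) else K $ j $ k - K $ i $ j * K $ i $ k / K $ i $ i)"

text \<open>An elementary change of variables in one coordinate: its Jacobian is a one-dimensional
  matter, and elimination reduces every positive definite form to such maps.\<close>

definition subst_row :: "'n \<Rightarrow> real ^ 'n \<Rightarrow> real ^ 'n ^ 'n" where
  "subst_row i r = (\<chi> k. if k = i then r else axis k 1)"

text \<open>The linear form whose square is split off when the square is completed in coordinate
  \<open>i\<close>.\<close>

definition pivot_row :: "'n \<Rightarrow> real ^ 'n ^ 'n \<Rightarrow> real ^ 'n" where
  "pivot_row i K = (1 / sqrt (K $ i $ i)) *\<^sub>R row i K"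

lemma spd_sym: "spd A \<Longrightarrow> A $ i $ j = A $ j $ i"
  unfolding spd_def by (metis transpose_def vec_lambda_beta)

lemma spd_pos: "spd A \<Longrightarrow> x \<noteq> 0 \<Longrightarrow> 0 < x \<bullet> (A *v x)"
  unfolding spd_def by blast

lemma spd_nonneg: "spd A \<Longrightarrow> 0 \<le> x \<bullet> (A *v x)"
  unfolding spd_def by (cases "x = 0") (auto simp: less_imp_le)

lemma spd_diag_pos:
  fixes A :: "real ^ 'n ^ 'n"
  assumes "spd A" shows "0 < A $ i $ i"
proof -
  have "axis i 1 \<bullet> (A *v axis i 1) = A $ i $ i"
    by (simp add: inner_axis' matrix_vector_mul_component inner_axis)
  moreover have "axis i (1::real) \<noteq> 0" by (simp add: axis_eq_0_iff)
  ultimately show ?thesis using spd_pos[OF assms] by metis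
qed

lemma spd_invertible:
  fixes A :: "real ^ 'n ^ 'n"
  assumes "spd A" shows "invertible A"
  using spd_pos[OF assms]
  by (metis inner_zero_right invertible_left_inverse less_irrefl matrix_left_invertible_ker)

lemma matrix_inv_mult:
  fixes A :: "real ^ 'n ^ 'n"
  assumes "invertible A"
  shows "A ** matrix_inv A = mat 1" "matrix_inv A ** A = mat 1"
  using someI_ex[OF assms[unfolded invertible_def]] unfolding matrix_inv_def by auto

lemma spd_matrix_inv:
  fixes A :: "real ^ 'n ^ 'n"
  assumes "spd A" shows "spd (matrix_inv A)"
  unfolding spd_def
proof (intro conjI allI impI)
  let ?B = "matrix_inv A"
  note inv = matrix_inv_mult[OF spd_invertible[OF assms]]
  have sym: "transpose A = A" using assms by (simp add: spd_def)
  show "transpose ?B = ?B"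
    using inv sym by (metis matrix_mul_assoc matrix_mul_lid matrix_mul_rid matrix_transpose_mul transpose_mat)
  fix x :: "real ^ 'n" assume "x \<noteq> 0"
  have x: "x = A *v (?B *v x)" by (simp add: inv matrix_vector_mul_assoc)
  then have "?B *v x \<noteq> 0" using \<open>x \<noteq> 0\<close> by (metis matrix_vector_mult_0_right)
  then show "0 < x \<bullet> (?B *v x)"
    using spd_pos[OF assms, of "?B *v x"] x by (metis inner_commute)
qed

lemma inner_congruence:
  fixes A B :: "real ^ 'n ^ 'n"
  shows "x \<bullet> ((transpose B ** A ** B) *v x) = (B *v x) \<bullet> (A *v (B *v x))"
proof -
  have "x \<bullet> (transpose B *v y) = (B *v x) \<bullet> y" for y
    by (metis dot_lmul_matrix vector_transpose_matrix)
  then show ?thesis by (simp only: matrix_vector_mul_assoc[symmetric])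
qed

lemma spd_congruence:
  fixes A B :: "real ^ 'n ^ 'n"
  assumes "spd A" "invertible B" shows "spd (transpose B ** A ** B)"
  unfolding spd_def
proof (intro conjI allI impI)
  show "transpose (transpose B ** A ** B) = transpose B ** A ** B"
    using assms(1) by (simp add: spd_def matrix_transpose_mul matrix_mul_assoc)
  fix x :: "real ^ 'n" assume "x \<noteq> 0"
  then have "B *v x \<noteq> 0"
    using assms(2) by (metis invertible_left_inverse matrix_left_invertible_ker)
  then show "0 < x \<bullet> ((transpose B ** A ** B) *v x)"
    unfolding inner_congruence by (rule spd_pos[OF assms(1)])
qed

lemma subst_row_mult_vec: "(subst_row i r *v x) $ k = (if k = i then r \<bullet> x else x $ k)"
  by (simp add: subst_row_def matrix_vector_mul_component inner_axis' )

lemma det_subst_row: "det (subst_row i r) = r $ i"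
proof -
  \<comment> \<open>The new row is expanded in the rows of the identity, the shape in which Cramer's
    rule reads off the determinant.\<close>
  have "subst_row i r = (\<chi> k. if k = i then sum (\<lambda>k. r $ k *s row k (mat 1)) UNIV else row k (mat 1))"
    by (auto simp: subst_row_def vec_eq_iff row_def mat_def axis_def if_distrib if_distribR sum.If_cases cong: if_cong)
  then show ?thesis using cramer_lemma_transpose[of i r "mat 1"] by simp
qed

text \<open>Completing the square as a congruence: the square of the form
  \<open>pivot_row i K\<close> plus the Schur form in the other coordinates gives back the form of
  \<open>K\<close>. The padding entry 1 at \<open>(i, i)\<close> is the coefficient of that
  square.\<close>

lemma schur_congruence:
  fixes K :: "real ^ 'n ^ 'n" and i :: 'n
  assumes "spd K"
  defines "R \<equiv> subst_row i (pivot_row i K)"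
  shows "K = transpose R ** schur i K ** R"
proof -
  have pos: "K $ i $ i > 0" using spd_diag_pos[OF assms(1)] .
  have R: "R $ a $ b = (if a = i then K $ i $ b / sqrt (K $ i $ i) else of_bool (a = b))" for a b
    by (auto simp: R_def subst_row_def pivot_row_def row_def axis_def)
  \<comment> \<open>The padded matrix has a unit row and column \<open>i\<close>, and
    \<open>R\<close> differs from the identity in row \<open>i\<close> only, so at most one term of
    each sum survives.\<close>
  have SR: "(schur i K ** R) $ a $ b = (if a = i then R $ i $ b
      else if b = i then 0 else K $ a $ b - K $ i $ a * K $ i $ b / K $ i $ i)" for a b
  proof -
    have "(schur i K ** R) $ a $ b = (\<Sum>k\<in>UNIV. schur i K $ a $ k * R $ k $ b)"
      by (simp add: matrix_matrix_mult_def)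
    also have "\<dots> = schur i K $ a $ i * R $ i $ b + (\<Sum>k\<in>UNIV - {i}. schur i K $ a $ k * R $ k $ b)"
      by (rule sum.remove) auto
    also have "(\<Sum>k\<in>UNIV - {i}. schur i K $ a $ k * R $ k $ b)
        = (\<Sum>k\<in>UNIV - {i}. if k = b then schur i K $ a $ b else 0)"
      by (rule sum.cong) (auto simp: R)
    finally show ?thesis by (auto simp: schur_def)
  qed
  have "(transpose R ** (schur i K ** R)) $ a $ b = K $ a $ b" for a b
  proof -
    have "(transpose R ** (schur i K ** R)) $ a $ b = (\<Sum>k\<in>UNIV. R $ k $ a * (schur i K ** R) $ k $ b)"
      by (simp add: matrix_matrix_mult_def transpose_def)
    also have "\<dots> = R $ i $ a * R $ i $ b + (\<Sum>k\<in>UNIV - {i}. R $ k $ a * (schur i K ** R) $ k $ b)"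
      by (subst sum.remove[of _ i]) (auto simp: SR)
    also have "(\<Sum>k\<in>UNIV - {i}. R $ k $ a * (schur i K ** R) $ k $ b)
        = (\<Sum>k\<in>UNIV - {i}. if k = a then (schur i K ** R) $ a $ b else 0)"
      by (rule sum.cong) (auto simp: R)
    also have "R $ i $ a * R $ i $ b = K $ i $ a * K $ i $ b / K $ i $ i"
      using pos by (simp add: R)
    finally show ?thesis
      using pos spd_sym[OF assms(1)] by (auto simp: SR)
  qed
  then show ?thesis by (simp add: vec_eq_iff matrix_mul_assoc)
qed

lemma det_pivot_row:
  fixes K :: "real ^ 'n ^ 'n"
  assumes "spd K"
  shows "det (subst_row i (pivot_row i K)) = sqrt (K $ i $ i)"
  using spd_diag_pos[OF assms, of i] by (simp add: det_subst_row pivot_row_def row_def real_div_sqrt)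

lemma invertible_pivot:
  fixes K :: "real ^ 'n ^ 'n"
  assumes "spd K" shows "invertible (subst_row i (pivot_row i K))"
  using spd_diag_pos[OF assms, of i] by (simp add: invertible_det_nz det_pivot_row[OF assms])

lemma det_schur:
  fixes K :: "real ^ 'n ^ 'n"
  assumes "spd K" shows "det K = K $ i $ i * det (schur i K)"
proof -
  have "det K = det (subst_row i (pivot_row i K)) * det (schur i K) * det (subst_row i (pivot_row i K))"
    using arg_cong[OF schur_congruence[OF assms, of i], of det] by (simp only: det_mul det_transpose)
  then show ?thesis
    using spd_diag_pos[OF assms, of i] by (simp add: det_pivot_row[OF assms])
qed

text \<open>The congruence is by an invertible matrix, so every vector is the image of one at which
  the form of \<open>K\<close> has the same value.\<close>

lemma spd_schur:
  fixes K :: "real ^ 'n ^ 'n"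
  assumes "spd K" shows "spd (schur i K)"
  unfolding spd_def
proof (intro conjI allI impI)
  show "transpose (schur i K) = schur i K"
    using spd_sym[OF assms] by (auto simp: schur_def transpose_def vec_eq_iff)
  fix y :: "real ^ 'n" assume "y \<noteq> 0"
  let ?R = "subst_row i (pivot_row i K)"
  obtain x where x: "y = ?R *v x"
    using matrix_inv_mult(1)[OF invertible_pivot[OF assms]]
    by (metis matrix_vector_mul_assoc matrix_vector_mul_lid)
  with \<open>y \<noteq> 0\<close> have "x \<noteq> 0" by auto
  then have "0 < x \<bullet> (K *v x)" by (rule spd_pos[OF assms])
  also have "\<dots> = y \<bullet> (schur i K *v y)"
    by (simp only: x inner_congruence[symmetric] schur_congruence[OF assms, symmetric])
  finally show "0 < y \<bullet> (schur i K *v y)" .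
qed

text \<open>Gaussian elimination as an induction principle at fixed dimension: every Schur step
  makes one more row a unit row, so finitely many steps lead to the identity.\<close>

lemma spd_induct [consumes 1, case_names one schur]:
  fixes K :: "real ^ 'n ^ 'n"
  assumes "spd K"
    and one: "P (mat 1)"
    and step: "\<And>K i. spd K \<Longrightarrow> P (schur i K) \<Longrightarrow> P K"
  shows "P K"
proof -
  \<comment> \<open>\<open>S\<close> holds the coordinates still to be eliminated.\<close>
  have "P K" if "finite S" "spd K" "\<forall>i j. i \<notin> S \<longrightarrow> K $ i $ j = of_bool (i = j)"
    for S and K :: "real ^ 'n ^ 'n"
    using that
  proof (induction S arbitrary: K)
    case empty
    then have "K = mat 1" by (auto simp: vec_eq_iff mat_def)
    with one show ?case by simp
  next
    case (insert i S)
    show ?case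
    proof (rule step[OF insert.prems(1)], rule insert.IH[OF spd_schur[OF insert.prems(1)]], intro allI impI)
      fix j k assume "j \<notin> S"
      \<comment> \<open>Row \<open>j\<close> is either the new unit row or an old one; for an old
        one, symmetry gives \<open>K $ i $ j = 0\<close>, so the correction term vanishes.\<close>
      show "schur i K $ j $ k = of_bool (j = k)"
        using insert.prems(2) \<open>j \<notin> S\<close> spd_sym[OF insert.prems(1), of i j] by (auto simp: schur_def)
    qed
  qed
  from this[of UNIV K] assms(1) show ?thesis by simp
qed

lemma det_spd_pos:
  fixes K :: "real ^ 'n ^ 'n"
  assumes "spd K" shows "0 < det K"
  using assms
proof (induction rule: spd_induct)
  case (schur K i)
  then show ?case using det_schur[of K i] spd_diag_pos[of K i] by simp
qed simp

text \<open>A Cholesky-type factor, collected as the product of the elementary factors of the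
  elimination.\<close>

lemma spd_factorization:
  fixes K :: "real ^ 'n ^ 'n"
  assumes "spd K" shows "\<exists>R :: real ^ 'n ^ 'n. invertible R \<and> K = transpose R ** R"
  using assms
proof (induction rule: spd_induct)
  case one
  have "invertible (mat 1 :: real ^ 'n ^ 'n)" by (auto simp: invertible_def)
  moreover have "mat 1 = transpose (mat 1) ** (mat 1 :: real ^ 'n ^ 'n)" by (simp add: transpose_mat)
  ultimately show ?case by blast
next
  case (schur K i)
  then obtain R :: "real ^ 'n ^ 'n" where R: "invertible R" "schur i K = transpose R ** R" by blast
  let ?P = "subst_row i (pivot_row i K)"
  have "K = transpose (R ** ?P) ** (R ** ?P)"
    by (subst schur_congruence[OF schur(1), of i], unfold R(2))
      (simp only: matrix_mul_assoc matrix_transpose_mul)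
  with R(1) invertible_pivot[OF schur(1)] show ?case by (blast intro: invertible_mult)
qed

section \<open>Trace against log-determinant\<close>

text \<open>One step lowers the quantity by exactly \<open>K $ i $ i - 1 - ln (K $ i $ i)\<close>
  plus the squared off-diagonal entries of row \<open>i\<close> over the pivot. Both parts are
  non-negative, and both vanish only if row \<open>i\<close> is a unit row, where the step changes
  nothing.\<close>

lemma trace_schur_le:
  fixes K :: "real ^ 'n ^ 'n"
  assumes "spd K"
  shows "trace (schur i K) - ln (det (schur i K)) \<le> trace K - ln (det K)"
    and "trace K - ln (det K) \<le> trace (schur i K) - ln (det (schur i K)) \<Longrightarrow> schur i K = K"
proof -
  have pos: "K $ i $ i > 0" using spd_diag_pos[OF assms] .
  have ln: "ln (K $ i $ i) \<le> K $ i $ i - 1" using ln_le_minus_one[OF pos] .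
  have "trace K = K $ i $ i + (\<Sum>j\<in>UNIV - {i}. K $ j $ j)"
    unfolding trace_def by (rule sum.remove) auto
  moreover have "trace (schur i K) = 1 + (\<Sum>j\<in>UNIV - {i}. K $ j $ j - (K $ i $ j)\<^sup>2 / K $ i $ i)"
    unfolding trace_def by (subst sum.remove[of _ i]) (auto simp: schur_def power2_eq_square intro!: sum.cong)
  moreover have "ln (det K) = ln (K $ i $ i) + ln (det (schur i K))"
    using det_schur[OF assms, of i] pos det_spd_pos[OF spd_schur[OF assms], of i] by (simp add: ln_mult)
  ultimately have eq: "trace K - ln (det K) = trace (schur i K) - ln (det (schur i K))
      + (K $ i $ i - 1 - ln (K $ i $ i)) + (\<Sum>j\<in>UNIV - {i}. (K $ i $ j)\<^sup>2 / K $ i $ i)"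
    by (simp add: sum_subtractf)
  have nn: "0 \<le> (\<Sum>j\<in>UNIV - {i}. (K $ i $ j)\<^sup>2 / K $ i $ i)"
    using pos by (intro sum_nonneg) auto
  show "trace (schur i K) - ln (det (schur i K)) \<le> trace K - ln (det K)"
    using eq ln nn by linarith
  assume "trace K - ln (det K) \<le> trace (schur i K) - ln (det (schur i K))"
  with eq ln nn have "ln (K $ i $ i) = K $ i $ i - 1"
    and 0: "(\<Sum>j\<in>UNIV - {i}. (K $ i $ j)\<^sup>2 / K $ i $ i) = 0" by linarith+
  then have ii: "K $ i $ i = 1" using ln_eq_minus_one pos by blast
  have ij: "K $ i $ j = 0" if "j \<noteq> i" for j
    using 0 that ii by (subst (asm) sum_nonneg_eq_0_iff) auto
  have ji: "K $ j $ i = 0" if "j \<noteq> i" for j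
    using ij[OF that] spd_sym[OF assms, of j i] by simp
  show "schur i K = K"
    using ii ij ji by (simp add: schur_def vec_eq_iff)
qed

text \<open>Along the elimination the quantity never increases, and at the identity it equals the
  dimension. The equality case supplies the strictness of the final decrease.\<close>

lemma ln_det_le_trace:
  fixes K :: "real ^ 'n ^ 'n"
  assumes "spd K"
  shows "real CARD('n) \<le> trace K - ln (det K)
    \<and> (trace K - ln (det K) \<le> real CARD('n) \<longrightarrow> K = mat 1)"
  using assms
proof (induction rule: spd_induct)
  case one
  show ?case by (simp add: trace_I)
next
  case (schur K i)
  let ?t = "trace K - ln (det K)" and ?s = "trace (schur i K) - ln (det (schur i K))"
  have "?s \<le> ?t" "?t \<le> ?s \<Longrightarrow> schur i K = K" using trace_schur_le[OF schur(1), of i] by blast+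
  moreover have "real CARD('n) \<le> ?s" "?s \<le> real CARD('n) \<Longrightarrow> schur i K = mat 1" using schur(2) by blast+
  ultimately show ?case by (metis order_trans)
qed

section \<open>Linear changes of variables\<close>

text \<open>Tonelli with coordinate \<open>i\<close> innermost, \<open>lborel\<close> being the
  image of a product measure over the basis.\<close>

lemma nn_integral_lborel_split:
  fixes g :: "real ^ 'n \<Rightarrow> ennreal"
  assumes [measurable]: "g \<in> borel_measurable borel"
  shows "(\<integral>\<^sup>+x. g x \<partial>lborel)
    = (\<integral>\<^sup>+x. (\<integral>\<^sup>+y. g ((\<Sum>b\<in>Basis - {axis i 1}. x b *\<^sub>R b) + y *\<^sub>R axis i 1) \<partial>lborel)
        \<partial>(\<Pi>\<^sub>M b\<in>Basis - {axis i 1}. lborel))"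
proof -
  let ?e = "axis i 1 :: real ^ 'n"
  let ?I = "Basis - {?e}"
  interpret product_sigma_finite "\<lambda>_. lborel :: real measure" ..
  have B: "Basis = insert ?e ?I" by auto
  have upd: "(\<Sum>b\<in>Basis. (x(?e := y)) b *\<^sub>R b) = (\<Sum>b\<in>?I. x b *\<^sub>R b) + y *\<^sub>R ?e" for x and y :: real
    by (subst sum.remove[of _ ?e]) (auto simp: add.commute)
  have "(\<integral>\<^sup>+x. g x \<partial>lborel)
      = (\<integral>\<^sup>+x. g (\<Sum>b\<in>Basis. x b *\<^sub>R b) \<partial>(\<Pi>\<^sub>M b\<in>Basis. lborel))"
    by (subst lborel_eq) (simp add: nn_integral_distr)
  also have "\<dots> = (\<integral>\<^sup>+x. g (\<Sum>b\<in>Basis. x b *\<^sub>R b) \<partial>(\<Pi>\<^sub>M b\<in>insert ?e ?I. lborel))"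
    using B by simp
  also have "\<dots> = (\<integral>\<^sup>+x. (\<integral>\<^sup>+y. g (\<Sum>b\<in>Basis. (x(?e := y)) b *\<^sub>R b) \<partial>lborel) \<partial>(\<Pi>\<^sub>M b\<in>?I. lborel))"
    by (rule product_nn_integral_insert) auto
  finally show ?thesis unfolding upd .
qed

text \<open>With the other coordinates frozen, the map acts on coordinate \<open>i\<close> as an
  affine function of slope \<open>r $ i\<close>, so the one-dimensional substitution rule yields the
  Jacobian.\<close>

lemma nn_integral_subst_row:
  fixes h :: "real ^ 'n \<Rightarrow> ennreal"
  assumes [measurable]: "h \<in> borel_measurable borel" and r: "r $ i \<noteq> 0"
  shows "(\<integral>\<^sup>+x. h x \<partial>lborel) = ennreal \<bar>r $ i\<bar> * (\<integral>\<^sup>+x. h (subst_row i r *v x) \<partial>lborel)"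
proof -
  let ?e = "axis i 1 :: real ^ 'n"
  let ?s = "\<lambda>x. \<Sum>b\<in>Basis - {?e}. x b *\<^sub>R b"
  have [measurable]: "(\<lambda>x. subst_row i r *v x) \<in> borel_measurable borel"
    by (intro borel_measurable_continuous_onI matrix_vector_mult_linear_continuous_on)
  have "b $ i = 0" if "b \<in> Basis - {?e}" for b :: "real ^ 'n"
    using that by (auto simp: Basis_vec_def axis_def split: if_splits)
  then have s0: "?s x $ i = 0" for x by (simp add: sum_component)
  have shear: "subst_row i r *v (?s x + y *\<^sub>R ?e) = ?s x + (r \<bullet> ?s x + r $ i * y) *\<^sub>R ?e" for x y
  proof -
    have "r \<bullet> (y *\<^sub>R ?e) = r $ i * y" by (simp add: inner_axis)
    moreover have "?e $ k = (if k = i then 1 else 0)" for k by (simp add: axis_def)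
    ultimately show ?thesis
      using s0[of x] by (simp add: vec_eq_iff subst_row_mult_vec inner_add_right del: sum_component)
  qed
  have "(\<integral>\<^sup>+x. h x \<partial>lborel)
      = (\<integral>\<^sup>+x. (\<integral>\<^sup>+y. h (?s x + y *\<^sub>R ?e) \<partial>lborel) \<partial>(\<Pi>\<^sub>M b\<in>Basis - {?e}. lborel))"
    by (rule nn_integral_lborel_split) simp
  also have "\<dots> = (\<integral>\<^sup>+x. ennreal \<bar>r $ i\<bar> * (\<integral>\<^sup>+y. h (?s x + (r \<bullet> ?s x + r $ i * y) *\<^sub>R ?e) \<partial>lborel)
      \<partial>(\<Pi>\<^sub>M b\<in>Basis - {?e}. lborel))"
    by (intro nn_integral_cong nn_integral_real_affine r) simp
  also have "\<dots> = ennreal \<bar>r $ i\<bar> * (\<integral>\<^sup>+x. (\<integral>\<^sup>+y. h (?s x + (r \<bullet> ?s x + r $ i * y) *\<^sub>R ?e) \<partial>lborel)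
      \<partial>(\<Pi>\<^sub>M b\<in>Basis - {?e}. lborel))"
    by (rule nn_integral_cmult) measurable
  also have "\<dots> = ennreal \<bar>r $ i\<bar> * (\<integral>\<^sup>+x. h (subst_row i r *v x) \<partial>lborel)"
    by (subst nn_integral_lborel_split[of "\<lambda>x. h (subst_row i r *v x)" i]) (auto simp: shear)
  finally show ?thesis .
qed

lemma borel_measurable_quadratic_form [measurable]:
  fixes K :: "real ^ 'n ^ 'n"
  shows "(\<lambda>x. x \<bullet> (K *v x)) \<in> borel_measurable borel"
  by (intro borel_measurable_continuous_onI continuous_intros matrix_vector_mult_linear_continuous_on)

text \<open>Each elimination step is one elementary substitution whose Jacobian is the square root
  of the pivot, and the pivots multiply to the determinant.\<close>

lemma nn_integral_quadratic_form:
  fixes K :: "real ^ 'n ^ 'n" and h :: "real \<Rightarrow> ennreal"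
  assumes "spd K" and [measurable]: "h \<in> borel_measurable borel"
  shows "(\<integral>\<^sup>+x. h (x \<bullet> x) \<partial>(lborel :: (real ^ 'n) measure))
    = ennreal (sqrt (det K)) * (\<integral>\<^sup>+x. h (x \<bullet> (K *v x)) \<partial>lborel)"
  using assms(1)
proof (induction rule: spd_induct)
  case one
  show ?case by simp
next
  case (schur K i)
  have pos: "K $ i $ i > 0" using spd_diag_pos[OF schur(1)] .
  have r: "pivot_row i K $ i = sqrt (K $ i $ i)"
    using det_pivot_row[OF schur(1), of i] by (simp add: det_subst_row)
  have "(\<integral>\<^sup>+x. h (x \<bullet> (schur i K *v x)) \<partial>lborel)
      = ennreal \<bar>pivot_row i K $ i\<bar> * (\<integral>\<^sup>+x. h (x \<bullet> (K *v x)) \<partial>lborel)"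
    using pos r
    by (subst nn_integral_subst_row[of _ "pivot_row i K" i])
       (auto simp: inner_congruence[symmetric] schur_congruence[OF schur(1), symmetric])
  with schur(2) have "(\<integral>\<^sup>+x. h (x \<bullet> x) \<partial>(lborel :: (real ^ 'n) measure))
      = ennreal (sqrt (det (schur i K))) * (ennreal (sqrt (K $ i $ i)) * (\<integral>\<^sup>+x. h (x \<bullet> (K *v x)) \<partial>lborel))"
    using pos by (simp add: r)
  also have "\<dots> = ennreal (sqrt (det K)) * (\<integral>\<^sup>+x. h (x \<bullet> (K *v x)) \<partial>lborel)"
    using pos det_spd_pos[OF spd_schur[OF schur(1), of i]] det_schur[OF schur(1), of i]
    by (simp add: mult.assoc[symmetric] ennreal_mult[symmetric] real_sqrt_mult mult.commute)
  finally show ?case .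
qed

section \<open>Normalisation of Student densities\<close>

text \<open>Dropping the summand 1 leaves a homogeneous power of the norm, which is geometric in
  \<open>n\<close> on dyadic scales.\<close>

lemma student_tail_bound:
  fixes x :: "'a :: real_normed_vector" and a \<nu> :: real
  assumes "\<nu> > 0" "a > 0" and n: "2 ^ n \<le> norm x"
  shows "(1 + (norm x)\<^sup>2 / \<nu>) powr (- (a / 2)) \<le> \<nu> powr (a / 2) * (2 powr (- a)) ^ n"
proof -
  have "(2 ^ n)\<^sup>2 / \<nu> \<le> (norm x)\<^sup>2 / \<nu>"
    using n \<open>\<nu> > 0\<close> by (intro divide_right_mono power_mono) auto
  then have "(1 + (norm x)\<^sup>2 / \<nu>) powr (- (a / 2)) \<le> ((2 ^ n)\<^sup>2 / \<nu>) powr (- (a / 2))"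
    using assms by (intro powr_mono2') auto
  also have "\<dots> = (2 ^ n)\<^sup>2 powr (- (a / 2)) * \<nu> powr (a / 2)"
    using \<open>\<nu> > 0\<close> by (simp add: powr_divide powr_minus divide_simps)
  also have "((2::real) ^ n)\<^sup>2 powr (- (a / 2)) = (2 powr (- a)) ^ n"
    by (simp add: powr_powr powr_realpow[symmetric] powr_power algebra_simps)
  finally show ?thesis by (simp add: mult.commute)
qed

text \<open>In dimension d, dyadic balls grow in volume by the factor \<open>2 ^ d\<close> per step,
  while the bound on the kernel shrinks by \<open>2 powr (- (\<nu> + d))\<close>; the series is
  geometric with ratio \<open>2 powr (- \<nu>)\<close>, below 1 because
  \<open>\<nu> > 0\<close>.\<close>

lemma nn_integral_student_base_finite:
  fixes \<nu> :: real
  assumes "\<nu> > 0"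
  shows "(\<integral>\<^sup>+x. ennreal ((1 + (x \<bullet> x) / \<nu>) powr (- ((\<nu> + real CARD('n)) / 2))) \<partial>(lborel :: (real ^ 'n) measure)) < \<infinity>"
proof -
  let ?d = "CARD('n)"
  define a where "a = \<nu> + real ?d"
  define q where "q = 2 powr (- a)"
  define V where "V = unit_ball_vol (real ?d)"
  let ?\<phi> = "\<lambda>x :: real ^ 'n. (1 + (x \<bullet> x) / \<nu>) powr (- (a / 2))"
  let ?B = "\<lambda>n. cball (0 :: real ^ 'n) (2 ^ Suc n)"
  let ?C = "\<nu> powr (a / 2)"
  have a: "a > 0" using assms by (simp add: a_def add_pos_nonneg)
  have q: "q > 0" by (simp add: q_def)
  have V: "V \<ge> 0" by (simp add: V_def)
  have single: "t n \<le> (\<Sum>k. t k)" for t :: "nat \<Rightarrow> ennreal" and n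
    using sum_le_suminf[of t "{n}"] by simp
  \<comment> \<open>Whole balls stand in for the dyadic shells; the overcounting does not affect
    convergence.\<close>
  have bound: "ennreal (?\<phi> x) \<le> indicator (cball 0 1) x + (\<Sum>n. ennreal (?C * q ^ n) * indicator (?B n) x)" for x
  proof (cases "norm x \<le> 1")
    case True
    have "?\<phi> x \<le> 1 powr (- (a / 2))"
      using assms a by (intro powr_mono2') auto
    then have "ennreal (?\<phi> x) \<le> indicator (cball 0 1) x"
      using True by simp
    then show ?thesis by (simp add: add_increasing2)
  next
    case False
    \<comment> \<open>The index of a dyadic shell containing \<open>x\<close>.\<close>
    define n where "n = nat \<lfloor>log 2 (norm x)\<rfloor>"
    have nx: "0 < norm x" "1 \<le> norm x" using False by linarith+
    then have "0 \<le> log 2 (norm x)" by (subst zero_le_log_cancel_iff) linarith+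
    then have n: "real n \<le> log 2 (norm x)" "log 2 (norm x) \<le> real (Suc n)"
      unfolding n_def by linarith+
    then have "2 powr real n \<le> norm x" "norm x \<le> 2 powr real (Suc n)"
      using nx by (subst (asm) le_log_iff log_le_iff; linarith)+
    then have "2 ^ n \<le> norm x" "norm x \<le> 2 ^ Suc n"
      by (simp_all only: powr_realpow zero_less_numeral)
    then have "ennreal (?\<phi> x) \<le> ennreal (?C * q ^ n) * indicator (?B n) x"
      using student_tail_bound[OF assms a, of n x] by (simp add: q_def power2_norm_eq_inner ennreal_leI)
    also have "\<dots> \<le> (\<Sum>k. ennreal (?C * q ^ k) * indicator (?B k) x)"
      by (rule single)
    finally show ?thesis by (simp add: add_increasing)
  qed
  have geo: "q * 2 ^ ?d = 2 powr (- \<nu>)"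
    by (simp add: q_def a_def powr_realpow[symmetric] powr_add[symmetric])
  then have geo1: "q * 2 ^ ?d < 1" using assms by (simp add: powr_less_one)
  have em: "ennreal (?C * q ^ n) * emeasure lborel (?B n) = ennreal (?C * V * 2 ^ ?d * (q * 2 ^ ?d) ^ n)" for n
    using V q by (simp add: emeasure_cball V_def[symmetric] ennreal_mult[symmetric] power_mult_distrib
        power_mult[symmetric] mult_ac)
  have "summable (\<lambda>n. ?C * V * 2 ^ ?d * (q * 2 ^ ?d) ^ n)"
    using geo1 q by (intro summable_mult summable_geometric) auto
  then have fin: "(\<Sum>n. ennreal (?C * V * 2 ^ ?d * (q * 2 ^ ?d) ^ n)) \<noteq> top"
    using V q by (intro ennreal_suminf_neq_top) auto
  have "(\<integral>\<^sup>+x. ennreal (?\<phi> x) \<partial>lborel)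
      \<le> (\<integral>\<^sup>+x. indicator (cball 0 1) x + (\<Sum>n. ennreal (?C * q ^ n) * indicator (?B n) x) \<partial>lborel)"
    by (intro nn_integral_mono bound)
  also have "\<dots> = emeasure lborel (cball (0 :: real ^ 'n) 1) + (\<Sum>n. ennreal (?C * q ^ n) * emeasure lborel (?B n))"
  proof -
    have meas: "(\<lambda>x. ennreal (?C * q ^ n) * indicator (?B n) x) \<in> borel_measurable lborel" for n
      by (intro borel_measurable_times_ennreal borel_measurable_indicator borel_measurable_const) auto
    have "(\<integral>\<^sup>+x. ennreal (?C * q ^ n) * indicator (?B n) x \<partial>lborel)
        = ennreal (?C * q ^ n) * emeasure lborel (?B n)" for n
      by (rule nn_integral_cmult_indicator) simp
    then have "(\<integral>\<^sup>+x. (\<Sum>n. ennreal (?C * q ^ n) * indicator (?B n) x) \<partial>lborel)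
        = (\<Sum>n. ennreal (?C * q ^ n) * emeasure lborel (?B n))"
      by (simp only: nn_integral_suminf[OF meas])
    then show ?thesis
      by (simp only: nn_integral_add[OF borel_measurable_indicator borel_measurable_suminf_order[OF meas]]
          nn_integral_indicator sets_lborel borel_closed closed_cball)
  qed
  also have "\<dots> < \<infinity>"
    using fin unfolding em by (simp add: emeasure_cball less_top)
  finally show ?thesis unfolding a_def .
qed

section \<open>Student kernels with arbitrary location and scale\<close>

lemma mahalanobis_nonneg: "\<theta> \<in> Params \<Longrightarrow> 0 \<le> mahalanobis \<theta> x"
  unfolding mahalanobis_def Params_def by (auto intro!: spd_nonneg spd_matrix_inv)

lemma borel_measurable_mahalanobis [measurable]: "mahalanobis \<theta> \<in> borel_measurable borel"
  unfolding mahalanobis_def by measurable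

lemma borel_measurable_student_kernel [measurable]: "student_kernel \<nu> \<theta> \<in> borel_measurable borel"
  unfolding student_kernel_def[abs_def] by measurable

lemma student_kernel_pos: "\<nu> > 0 \<Longrightarrow> \<theta> \<in> Params \<Longrightarrow> 0 < student_kernel \<nu> \<theta> x"
  using mahalanobis_nonneg[of \<theta> x]
  by (auto simp: student_kernel_def intro!: powr_gt_zero[THEN iffD2] add_pos_nonneg less_imp_neq[symmetric])

lemma det_matrix_inv:
  fixes A :: "real ^ 'n ^ 'n"
  assumes "invertible A" shows "det (matrix_inv A) = 1 / det A"
  using matrix_inv_mult(1)[OF assms] assms
  by (metis det_I det_mul invertible_det_nz nonzero_eq_divide_eq mult.commute)

text \<open>Translation moves the location to the origin; the kernel is then a function of the form
  of the inverse scale matrix, whose determinant is the inverse of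
  \<open>det (snd \<theta>)\<close>.\<close>

lemma nn_integral_student_kernel:
  fixes \<theta> :: "(real ^ 'n) \<times> (real ^ 'n ^ 'n)"
  assumes "\<theta> \<in> Params"
  shows "(\<integral>\<^sup>+x. ennreal (student_kernel \<nu> \<theta> x) \<partial>lborel) = ennreal (sqrt (det (snd \<theta>))) *
    (\<integral>\<^sup>+x. ennreal ((1 + (x \<bullet> x) / \<nu>) powr (- ((\<nu> + real CARD('n)) / 2))) \<partial>(lborel :: (real ^ 'n) measure))"
proof -
  let ?K = "matrix_inv (snd \<theta>)"
  let ?h = "\<lambda>r. ennreal ((1 + r / \<nu>) powr (- ((\<nu> + real CARD('n)) / 2)))"
  have spd: "spd (snd \<theta>)" using assms by (auto simp: Params_def)
  have pos: "det (snd \<theta>) > 0" by (rule det_spd_pos[OF spd])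
  have "(\<integral>\<^sup>+x. ennreal (student_kernel \<nu> \<theta> x) \<partial>lborel)
      = (\<integral>\<^sup>+x. ennreal (student_kernel \<nu> \<theta> x) \<partial>distr lborel borel ((+) (fst \<theta>)))"
    by (simp add: lborel_distr_plus)
  also have "\<dots> = (\<integral>\<^sup>+x. ?h (x \<bullet> (?K *v x)) \<partial>lborel)"
    by (subst nn_integral_distr) (auto simp: student_kernel_def mahalanobis_def)
  finally have "ennreal (sqrt (det ?K)) * (\<integral>\<^sup>+x. ennreal (student_kernel \<nu> \<theta> x) \<partial>lborel)
      = (\<integral>\<^sup>+x. ?h (x \<bullet> x) \<partial>(lborel :: (real ^ 'n) measure))"
    by (subst nn_integral_quadratic_form[OF spd_matrix_inv[OF spd]]) auto
  then have "(\<integral>\<^sup>+x. ?h (x \<bullet> x) \<partial>(lborel :: (real ^ 'n) measure))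
     = ennreal (1 / sqrt (det (snd \<theta>))) * (\<integral>\<^sup>+x. ennreal (student_kernel \<nu> \<theta> x) \<partial>lborel)"
    by (simp add: det_matrix_inv[OF spd_invertible[OF spd]] real_sqrt_divide)
  then show ?thesis
    using pos by (simp add: mult.assoc[symmetric] ennreal_mult[symmetric])
qed

text \<open>A single \<open>c\<close>, the integral of the kernel at location 0 and identity scale,
  serves all parameters, so that it cancels in ratios of Student densities.\<close>

lemma student_normalizer:
  fixes \<nu> :: real
  assumes "\<nu> > 0"
  obtains c where "c > 0"
    "\<And>\<theta> :: (real ^ 'n) \<times> (real ^ 'n ^ 'n). \<theta> \<in> Params \<Longrightarrow> integrable lebesgue (student_kernel \<nu> \<theta>)"
    "\<And>\<theta> :: (real ^ 'n) \<times> (real ^ 'n ^ 'n). \<theta> \<in> Params \<Longrightarrow>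
       (\<integral>x. student_kernel \<nu> \<theta> x \<partial>lebesgue) = sqrt (det (snd \<theta>)) * c"
proof -
  let ?\<phi> = "\<lambda>x :: real ^ 'n. (1 + (x \<bullet> x) / \<nu>) powr (- ((\<nu> + real CARD('n)) / 2))"
  let ?I = "\<integral>\<^sup>+x. ennreal (?\<phi> x) \<partial>lborel"
  obtain c where c: "?I = ennreal c" "c \<ge> 0"
    using nn_integral_student_base_finite[where 'n = 'n, OF assms] by (cases ?I) auto
  \<comment> \<open>A positive integrand with integral zero would make the whole space a null
    set.\<close>
  have "?I \<noteq> 0"
  proof
    assume "?I = 0"
    then have "AE x in lborel. ennreal (?\<phi> x) = 0"
      by (subst (asm) nn_integral_0_iff_AE) auto
    moreover have "1 + (x \<bullet> x) / \<nu> > 0" for x :: "real ^ 'n" using assms by (simp add: add_pos_nonneg)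
    then have "ennreal (?\<phi> x) \<noteq> 0" for x by (simp add: ennreal_eq_0_iff less_imp_neq[symmetric])
    ultimately have "AE x in (lborel :: (real ^ 'n) measure). x \<notin> UNIV" by simp
    then show False by (subst (asm) AE_iff_null_sets[symmetric]) (auto simp: null_sets_def)
  qed
  with c have "c > 0" by (cases "c = 0") auto
  moreover have "has_bochner_integral lebesgue (student_kernel \<nu> \<theta>) (sqrt (det (snd \<theta>)) * c)"
    if "\<theta> \<in> Params" for \<theta> :: "(real ^ 'n) \<times> (real ^ 'n ^ 'n)"
  proof (rule has_bochner_integral_nn_integral)
    have "det (snd \<theta>) > 0" using that det_spd_pos by (auto simp: Params_def)
    then show "0 \<le> sqrt (det (snd \<theta>)) * c" using c by simp
    show "(\<integral>\<^sup>+x. ennreal (student_kernel \<nu> \<theta> x) \<partial>lebesgue) = ennreal (sqrt (det (snd \<theta>)) * c)"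
      unfolding nn_integral_completion nn_integral_student_kernel[OF that] c(1)
      using \<open>det (snd \<theta>) > 0\<close> c(2) by (simp add: ennreal_mult)
  qed (use student_kernel_pos[OF assms that] in \<open>auto simp: less_imp_le intro: measurable_completion\<close>)
  ultimately show thesis
    by (intro that[of c]) (auto simp: has_bochner_integral_iff)
qed

section \<open>Rank-based weights\<close>

text \<open>The weight as a function of the level \<open>t\<close>, with \<open>M\<close> the law of
  the objective value. On the real line it is antitone for antitone \<open>w\<close>, which gives
  measurability for any measurable objective.\<close>

definition rank_weight :: "(real \<Rightarrow> real) \<Rightarrow> real measure \<Rightarrow> real \<Rightarrow> real" where
  "rank_weight w M t =
     (if measure M {..t} = measure M {..<t} then w (measure M {..t})
      else (1 / (measure M {..t} - measure M {..<t})) * integral {measure M {..<t}..measure M {..t}} w)"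

lemma antimono_on_integrable:
  fixes w :: "real \<Rightarrow> real"
  assumes "antimono_on {a..b} w" shows "w integrable_on {a..b}"
proof -
  have "mono_on {a..b} (\<lambda>x. - w x)"
    using assms by (auto simp: monotone_on_def)
  from integrable_on_mono_on[OF this] show ?thesis by (simp add: integrable_neg_iff)
qed

lemma (in real_distribution)
  shows measure_lessThan_le: "measure M {..<t} \<le> measure M {..t}"
    and measure_atMost_le: "s < t \<Longrightarrow> measure M {..s} \<le> measure M {..<t}"
  by (intro finite_measure_mono; auto)+

text \<open>At an atom the weight averages \<open>w\<close> over the jump, hence lies between the
  values at its two ends; elsewhere the three values coincide.\<close>

lemma (in real_distribution) rank_weight_bounds:
  fixes w :: "real \<Rightarrow> real"
  assumes w: "antimono_on {0..1} w"
  shows "w (measure M {..t}) \<le> rank_weight w M t" "rank_weight w M t \<le> w (measure M {..<t})"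
proof -
  define L F where LF: "L = measure M {..<t}" "F = measure M {..t}"
  have range: "0 \<le> L" "L \<le> F" "F \<le> 1" using measure_lessThan_le by (auto simp: LF)
  have anti: "w v \<le> w u" if "0 \<le> u" "u \<le> v" "v \<le> 1" for u v
    using w that by (auto simp: monotone_on_def)
  have "w F \<le> rank_weight w M t \<and> rank_weight w M t \<le> w L"
  proof (cases "F = L")
    case False
    with range have lt: "L < F" by simp
    have int: "w integrable_on {L..F}"
      using range by (intro antimono_on_integrable monotone_on_subset[OF w]) auto
    have "integral {L..F} (\<lambda>_. w F) \<le> integral {L..F} w"
      using range by (intro integral_le int integrable_const_ivl anti) auto
    moreover have "integral {L..F} w \<le> integral {L..F} (\<lambda>_. w L)"
      using range by (intro integral_le int integrable_const_ivl anti) auto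
    ultimately show ?thesis
      using lt by (simp add: rank_weight_def LF[symmetric] field_simps)
  qed (simp add: rank_weight_def LF[symmetric])
  then show "w (measure M {..t}) \<le> rank_weight w M t" "rank_weight w M t \<le> w (measure M {..<t})" by (auto simp: LF)
qed

text \<open>The jump intervals of two levels are ordered, so the two-sided bounds chain through the
  gap between them.\<close>

lemma (in real_distribution) antimono_rank_weight:
  assumes "antimono_on {0..1} w" shows "antimono (rank_weight w M)"
proof (rule antimonoI)
  fix s t :: real assume "s \<le> t"
  show "rank_weight w M t \<le> rank_weight w M s"
  proof (cases "s = t")
    case False
    with \<open>s \<le> t\<close> have "s < t" by simp
    have "rank_weight w M t \<le> w (measure M {..<t})" by (rule rank_weight_bounds[OF assms])
    also have "\<dots> \<le> w (measure M {..s})"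
      using assms measure_atMost_le[OF \<open>s < t\<close>] by (auto simp: monotone_on_def)
    also have "\<dots> \<le> rank_weight w M s" by (rule rank_weight_bounds[OF assms])
    finally show ?thesis .
  qed simp
qed

text \<open>
  If the distribution function takes no value strictly between \<open>0\<close> and \<open>u\<close>, then it jumps from \<open>0\<close>
  to at least \<open>u\<close> at a single point, and this point is an atom with \<open>measure M {..<t} = 0\<close>.
\<close>

lemma (in real_distribution) prob_low_rank_pos:
  assumes "0 < u"
  shows "\<exists>t. 0 < measure M {..t} \<and> measure M {..<t} < u"
proof (cases "\<exists>t. 0 < measure M {..t} \<and> measure M {..t} < u")
  case True
  then obtain t where "0 < measure M {..t}" "measure M {..t} < u" by blast
  then show ?thesis using measure_lessThan_le[of t] by (intro exI[of _ t]) simp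
next
  case False
  interpret finite_borel_measure M by (rule finite_borel_measure_M)
  let ?S = "{t. 0 < cdf M t}"
  have gap: "u \<le> cdf M t" if "t \<in> ?S" for t
    using False that by (force simp: cdf_def2)
  have "eventually (\<lambda>t. 0 < cdf M t) at_top"
    using cdf_lim_at_top_prob by (rule order_tendstoD) simp
  then have ne: "?S \<noteq> {}" by (auto simp: eventually_at_top_linorder)
  have "eventually (\<lambda>t. cdf M t < u) at_bot"
    using cdf_lim_at_bot assms by (rule order_tendstoD)
  then obtain a where a: "cdf M t < u" if "t \<le> a" for t by (auto simp: eventually_at_bot_linorder)
  have bdd: "bdd_below ?S"
  proof (rule bdd_belowI[of _ a])
    fix t assume "t \<in> ?S"
    then show "a \<le> t" using gap[of t] a[of t] by linarith
  qed
  define s where "s = Inf ?S"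
  have "u \<le> cdf M t" if st: "s < t" for t
  proof -
    obtain r where "r \<in> ?S" "r < t" 
      using cInf_lessD[OF ne, of t] st by (auto simp: s_def)
    then show ?thesis using gap[of r] cdf_nondecreasing[of r t] by linarith
  qed
  then have "eventually (\<lambda>t. u \<le> cdf M t) (at_right s)"
    by (simp add: eventually_at_filter)
  moreover have "(cdf M \<longlongrightarrow> cdf M s) (at_right s)"
    using cdf_is_right_cont by (simp add: continuous_within)
  ultimately have "u \<le> cdf M s"
    by (intro tendsto_lowerbound) auto
  moreover have "cdf M t = 0" if "t < s" for t
  proof (rule ccontr)
    assume "cdf M t \<noteq> 0"
    then have "t \<in> ?S" using cdf_nonneg[of t] by simp
    from cInf_lower[OF this bdd] that show False by (simp add: s_def)
  qed
  then have "eventually (\<lambda>t. cdf M t = 0) (at_left s)"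
    by (simp add: eventually_at_filter)
  then have "(cdf M \<longlongrightarrow> 0) (at_left s)" by (rule tendsto_eventually)
  then have "measure M {..<s} = 0"
    using cdf_at_left[of s] tendsto_unique trivial_limit_at_left_real by blast
  ultimately show ?thesis using assms by (auto simp: cdf_def2 intro!: exI[of _ s])
qed

text \<open>Ensures that the target has positive mass. A positive integral forces
  \<open>w u > 0\<close> for some \<open>u > 0\<close>, hence on \<open>[0,u]\<close>; a level of
  positive probability whose lower rank is below \<open>u\<close> then carries positive
  weight.\<close>

lemma (in real_distribution) rank_weight_pos:
  fixes w :: "real \<Rightarrow> real"
  assumes nonneg: "\<And>u. u \<in> {0..1} \<Longrightarrow> 0 \<le> w u"
    and w: "antimono_on {0..1} w" and pos: "integral {0..1} w > 0"
  shows "\<exists>t. 0 < measure M {..t} \<and> 0 < rank_weight w M t"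
proof -
  have "\<exists>u. 0 < u \<and> u \<le> 1 \<and> 0 < w u"
  proof (rule ccontr)
    assume "\<not> ?thesis"
    then have zero: "w u = 0" if "u \<in> {0..1} - {0}" for u
      using that nonneg[of u] by (auto simp: not_less intro: antisym)
    \<comment> \<open>The value at 0 alone does not influence the integral, so that point is
      discarded as a null set.\<close>
    have "integral {0..1} w = integral {0..1} (\<lambda>_ :: real. 0)"
      by (rule integral_spike[of "{0}"]) (use zero in auto)
    with pos show False by simp
  qed
  then obtain u where u: "0 < u" "u \<le> 1" "0 < w u" by blast
  obtain t where t: "0 < measure M {..t}" "measure M {..<t} < u"
    using prob_low_rank_pos[OF u(1)] by blast
  define L F where LF: "L = measure M {..<t}" "F = measure M {..t}"
  have range: "0 \<le> L" "L \<le> F" "F \<le> 1" using measure_lessThan_le by (auto simp: LF)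
  have anti: "w u \<le> w v" if "0 \<le> v" "v \<le> u" for v
    using w that u by (auto simp: monotone_on_def)
  have "0 < rank_weight w M t"
  proof (cases "F \<le> u")
    case True
    then have "w u \<le> w F" using range by (intro anti) auto
    with rank_weight_bounds(1)[OF w, of t] u show ?thesis unfolding LF by linarith
  next
    case False
    then have lt: "L < F" using t LF by simp
    have int: "w integrable_on {L..F}"
      using range by (intro antimono_on_integrable monotone_on_subset[OF w]) auto
    have sub: "w integrable_on {L..u}"
      using range u by (intro antimono_on_integrable monotone_on_subset[OF w]) auto
    \<comment> \<open>The part \<open>[L, u]\<close> of the jump already contributes a positive
      amount to the average.\<close>
    have "0 < (u - L) * w u" using t u LF by simp
    also have "\<dots> = integral {L..u} (\<lambda>_. w u)" using t LF by simp
    also have "\<dots> \<le> integral {L..u} w"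
      using range by (intro integral_le sub integrable_const_ivl anti) auto
    also have "\<dots> \<le> integral {L..F} w"
      using False range nonneg by (intro integral_subset_le sub int) auto
    finally show ?thesis using lt by (simp add: rank_weight_def LF[symmetric])
  qed
  with t show ?thesis by blast
qed

section \<open>The target as a reweighted proposal\<close>

lemma space_law: "space (law p) = UNIV"
  by (simp add: law_def)

lemma weight_eq_rank_weight:
  assumes p: "\<And>x. 0 \<le> p x" "integrable lebesgue p"
    and f: "f \<in> borel_measurable lebesgue"
  shows "weight w f p x = rank_weight w (distr (law p) borel f) (f x)"
proof -
  have [measurable]: "f \<in> borel_measurable (law p)" using f by (simp add: law_def)
  have "q_le f p x = measure (distr (law p) borel f) {..f x}"
    "q_less f p x = measure (distr (law p) borel f) {..<f x}"
    by (simp_all add: q_le_def q_less_def measure_distr vimage_def space_law)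
  then show ?thesis by (simp add: weight_def rank_weight_def)
qed

lemma prob_space_law:
  assumes "\<And>x. 0 \<le> p x" "integrable lebesgue p" "(\<integral>x. p x \<partial>lebesgue) = 1"
  shows "prob_space (law p)"
proof
  have "emeasure (law p) (space (law p)) = (\<integral>\<^sup>+x. ennreal (p x) \<partial>lebesgue)"
    unfolding law_def using assms(2) by (subst emeasure_density) auto
  also have "\<dots> = 1" using assms by (subst nn_integral_eq_integral) auto
  finally show "emeasure (law p) (space (law p)) = 1" .
qed

text \<open>Isolates what the later estimates use about the weights: the target is the proposal
  times a bounded measurable ratio, and its mass is positive.\<close>

lemma target_bounds:
  fixes p :: "real ^ 'n \<Rightarrow> real" and w :: "real \<Rightarrow> real"
  assumes p: "\<And>x. 0 \<le> p x" "integrable lebesgue p" "(\<integral>x. p x \<partial>lebesgue) = 1"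
    and f: "f \<in> borel_measurable lebesgue"
    and nonneg: "\<And>u. u \<in> {0..1} \<Longrightarrow> 0 \<le> w u"
    and w: "antimono_on {0..1} w" and pos: "integral {0..1} w > 0"
  obtains r C where "r \<in> borel_measurable lebesgue" "\<And>x. 0 \<le> r x" "\<And>x. r x \<le> C"
    "target w f p = (\<lambda>x. r x * p x)" "0 < (\<integral>x. r x * p x \<partial>lebesgue)"
proof -
  let ?D = "distr (law p) borel f"
  define W where "W = rank_weight w ?D"
  define Z where "Z = integral {0..1} w"
  define r where "r x = W (f x) / Z" for x
  have meas [measurable]: "f \<in> borel_measurable (law p)" using f by (simp add: law_def)
  interpret P: prob_space "law p" by (rule prob_space_law[OF p])
  interpret D: real_distribution ?D by (rule P.real_distribution_distr) simp
  have anti: "antimono W" unfolding W_def by (rule D.antimono_rank_weight[OF w])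
  \<comment> \<open>Monotone functions are Borel; the sign is flipped because \<open>W\<close> is
    antitone.\<close>
  have "mono (\<lambda>t. - W t)" using anti by (auto simp: monotone_def)
  then have "(\<lambda>t. - (- W t)) \<in> borel_measurable borel"
    by (intro borel_measurable_uminus borel_measurable_mono)
  then have W: "W \<in> borel_measurable borel" by simp
  have r [measurable]: "r \<in> borel_measurable lebesgue"
    unfolding r_def using measurable_compose[OF f W] by simp
  have W0: "0 \<le> W t" for t
    using nonneg[of "measure ?D {..t}"] D.rank_weight_bounds(1)[OF w, of t] unfolding W_def by force
  have W1: "W t \<le> w 0" for t
  proof -
    have "w (measure ?D {..<t}) \<le> w 0" using w by (auto simp: monotone_on_def)
    with D.rank_weight_bounds(2)[OF w, of t] show ?thesis unfolding W_def by linarith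
  qed
  have r0: "0 \<le> r x" for x using W0 pos by (simp add: r_def Z_def)
  have r1: "r x \<le> w 0 / Z" for x using W1 pos by (simp add: r_def Z_def divide_right_mono)
  have tgt: "target w f p = (\<lambda>x. r x * p x)"
    by (auto simp: target_def r_def W_def Z_def weight_eq_rank_weight[OF p(1,2) f])
  have int: "integrable lebesgue (\<lambda>x. r x * p x)"
  proof (rule Bochner_Integration.integrable_bound[of lebesgue "\<lambda>x. w 0 / Z * p x"])
    show "integrable lebesgue (\<lambda>x. w 0 / Z * p x)" using p(2) by simp
    show "(\<lambda>x. r x * p x) \<in> borel_measurable lebesgue" using r p(2) by measurable
    show "AE x in lebesgue. norm (r x * p x) \<le> norm (w 0 / Z * p x)"
    proof (rule AE_I2)
      fix x
      have "0 \<le> r x * p x" "r x * p x \<le> w 0 / Z * p x"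
        using mult_right_mono[OF r1 p(1)] r0 p(1) by auto
      then show "norm (r x * p x) \<le> norm (w 0 / Z * p x)"
        unfolding real_norm_def by linarith
    qed
  qed
  obtain t where t: "0 < measure ?D {..t}" "0 < W t"
    using D.rank_weight_pos[OF nonneg w pos] unfolding W_def by blast
  \<comment> \<open>On the sublevel set of \<open>t\<close>, which has positive probability, the
    ratio is at least \<open>W t / Z\<close>; this bounds the mass from below.\<close>
  have "0 < W t / Z * measure ?D {..t}" using t pos by (simp add: Z_def)
  also have "\<dots> = (\<integral>x. W t / Z * indicator {x. f x \<le> t} x \<partial>law p)"
    by (simp add: measure_distr vimage_def space_law)
  also have "\<dots> = (\<integral>x. p x * (W t / Z * indicator {x. f x \<le> t} x) \<partial>lebesgue)"
  proof -
    have "(\<lambda>x. W t / Z * indicator {x. f x \<le> t} x) \<in> borel_measurable lebesgue"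
      using f by measurable
    from integral_density[OF this, of p] p show ?thesis by (simp add: law_def)
  qed
  also have "\<dots> \<le> (\<integral>x. r x * p x \<partial>lebesgue)"
  proof (rule integral_mono_AE')
    show "AE x in lebesgue. p x * (W t / Z * indicator {x. f x \<le> t} x) \<le> r x * p x"
    proof (rule AE_I2)
      fix x :: "real ^ 'n"
      have "W t / Z * indicator {x. f x \<le> t} x \<le> r x"
        using antimonoD[OF anti, of "f x" t] r0[of x] pos
        by (auto simp: r_def Z_def indicator_def intro!: divide_right_mono)
      then show "p x * (W t / Z * indicator {x. f x \<le> t} x) \<le> r x * p x"
        using mult_left_mono[OF _ p(1)[of x]] by (simp only: mult.commute[of "r x"])
    qed
  qed (use int p r0 in auto)
  finally have "0 < (\<integral>x. r x * p x \<partial>lebesgue)" .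
  from that[OF r r0 r1 tgt this] show thesis .
qed

section \<open>Divergence and moments\<close>

lemma
  fixes f :: "'a \<Rightarrow> ('b :: euclidean_space) ^ 'n"
  assumes "\<And>i. integrable M (\<lambda>x. f x $ i)"
  shows integrable_vec: "integrable M f"
    and integral_vec_nth: "(\<integral>x. f x \<partial>M) $ i = (\<integral>x. f x $ i \<partial>M)"
proof -
  have lin: "bounded_linear (axis i :: 'b \<Rightarrow> 'b ^ 'n)" for i
    by (intro linear_conv_bounded_linear[THEN iffD1] linearI) (auto simp: axis_def vec_eq_iff)
  have f: "f = (\<lambda>x. \<Sum>i\<in>UNIV. axis i (f x $ i))"
    by (auto simp: vec_eq_iff axis_def fun_eq_iff)
  show int: "integrable M f"
    by (subst f) (intro Bochner_Integration.integrable_sum integrable_bounded_linear[OF lin] assms)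
  show "(\<integral>x. f x \<partial>M) $ i = (\<integral>x. f x $ i \<partial>M)"
    by (rule integral_bounded_linear[OF bounded_linear_vec_nth int, symmetric])
qed

text \<open>With both parts finite, the extended-real difference is a Bochner integral, so
  divergences can be compared by linearity.\<close>

lemma KL_eq_integral:
  fixes p1 p2 :: "real ^ 'n \<Rightarrow> real"
  assumes "integrable lebesgue (\<lambda>x. ln (p1 x / p2 x) * p1 x)"
  shows "KL p1 p2 = ereal (\<integral>x. ln (p1 x / p2 x) * p1 x \<partial>lebesgue)"
proof -
  let ?f = "\<lambda>x. ln (p1 x / p2 x) * p1 x"
  have fin: "(\<integral>\<^sup>+x. ennreal (?f x) \<partial>lebesgue) \<noteq> top" "(\<integral>\<^sup>+x. ennreal (- ?f x) \<partial>lebesgue) \<noteq> top"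
    using assms by (simp_all add: real_integrable_def)
  have e: "enn2ereal y = ereal (enn2real y)" if "y \<noteq> top" for y :: ennreal
    using that by (cases y) (auto simp: enn2ereal_ennreal)
  show ?thesis
    unfolding KL_def real_lebesgue_integral_def[OF assms] e[OF fin(1)] e[OF fin(2)] by simp
qed

text \<open>Both bounds come from \<open>ln y \<le> y - 1\<close>, at \<open>y = r\<close> and at
  \<open>y = 1 / r\<close>. The result makes the divergence of the target from the proposal
  finite.\<close>

lemma abs_mult_ln_le:
  fixes r C :: real
  assumes "0 \<le> r" "r \<le> C" shows "\<bar>r * ln r\<bar> \<le> 1 + C\<^sup>2"
proof (cases "r = 0")
  case False
  with assms have r: "r > 0" by simp
  have "r * ln r \<le> r * (r - 1)" using r by (intro mult_left_mono ln_le_minus_one) auto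
  also have "\<dots> \<le> C\<^sup>2" using assms mult_mono[of r C r C] by (simp add: algebra_simps power2_eq_square)
  finally have upper: "r * ln r \<le> C\<^sup>2" .
  have "r * ln (1 / r) \<le> r * (1 / r - 1)" using r by (intro mult_left_mono ln_le_minus_one) auto
  then have "- (r * ln r) \<le> 1 - r" using r by (simp add: ln_div algebra_simps)
  with upper r show ?thesis by (simp add: abs_le_iff add_increasing add_increasing2)
qed simp

section \<open>Comparison of Mahalanobis distances\<close>

text \<open>The factor \<open>R\<close> of the inverse scale matrix has a bounded inverse. It
  follows that \<open>\<gamma>\<close> times a quadratic is bounded, so the weighted second moments
  exist even though Student densities with small \<open>\<nu>\<close> have none.\<close>

lemma norm_sq_le_mahalanobis:
  fixes \<theta> :: "(real ^ 'n) \<times> (real ^ 'n ^ 'n)"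
  assumes "\<theta> \<in> Params" "\<nu> > 0"
  shows "\<exists>B>0. \<forall>x. 1 + (norm x)\<^sup>2 \<le> B * (\<nu> + mahalanobis \<theta> x)"
proof -
  let ?K = "matrix_inv (snd \<theta>)"
  have "spd ?K" using assms by (auto simp: Params_def intro: spd_matrix_inv)
  then obtain R :: "real ^ 'n ^ 'n" where R: "invertible R" "?K = transpose R ** R"
    using spd_factorization by blast
  have M: "mahalanobis \<theta> x = (norm (R *v (x - fst \<theta>)))\<^sup>2" for x
    using inner_congruence[of "x - fst \<theta>" R "mat 1"] by (simp add: mahalanobis_def R(2) power2_norm_eq_inner)
  define c where "c = onorm ((*v) (matrix_inv R))"
  have bl: "bounded_linear ((*v) (matrix_inv R))" by (rule matrix_vector_mul_bounded_linear)
  have c: "norm y \<le> c * norm (R *v y)" for y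
    using onorm[OF bl, of "R *v y"] matrix_inv_mult(2)[OF R(1)]
    by (simp add: c_def matrix_vector_mul_assoc)
  \<comment> \<open>The quotient by \<open>\<nu>\<close> absorbs the constant and the location, the
    other summand the growth of the distance.\<close>
  define B where "B = (1 + 2 * (norm (fst \<theta>))\<^sup>2) / \<nu> + 2 * c\<^sup>2"
  have "1 + (norm x)\<^sup>2 \<le> B * (\<nu> + mahalanobis \<theta> x)" for x
  proof -
    let ?y = "x - fst \<theta>"
    have "norm x \<le> norm ?y + norm (fst \<theta>)" using norm_triangle_ineq[of ?y "fst \<theta>"] by simp
    then have "(norm x)\<^sup>2 \<le> (norm ?y + norm (fst \<theta>))\<^sup>2" by (intro power_mono) auto
    also have "\<dots> \<le> 2 * (norm ?y)\<^sup>2 + 2 * (norm (fst \<theta>))\<^sup>2"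
      using sum_squares_bound[of "norm ?y" "norm (fst \<theta>)"] by (simp add: power2_sum)
    also have "(norm ?y)\<^sup>2 \<le> c\<^sup>2 * mahalanobis \<theta> x"
      unfolding M power_mult_distrib[symmetric] by (intro power_mono c) auto
    finally have "1 + (norm x)\<^sup>2 \<le> (1 + 2 * (norm (fst \<theta>))\<^sup>2) + 2 * c\<^sup>2 * mahalanobis \<theta> x" by simp
    also have "\<dots> \<le> B * (\<nu> + mahalanobis \<theta> x)"
    proof -
      have "0 \<le> (1 + 2 * (norm (fst \<theta>))\<^sup>2) / \<nu> * mahalanobis \<theta> x" "0 \<le> 2 * c\<^sup>2 * \<nu>"
        using assms mahalanobis_nonneg[OF assms(1), of x] by auto
      moreover have "(1 + 2 * (norm (fst \<theta>))\<^sup>2) / \<nu> * \<nu> = 1 + 2 * (norm (fst \<theta>))\<^sup>2"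
        using assms by simp
      ultimately show ?thesis unfolding B_def distrib_left distrib_right by linarith
    qed
    finally show ?thesis .
  qed
  moreover have "B > 0" using assms by (simp add: B_def add_pos_nonneg)
  ultimately show ?thesis by blast
qed

lemma mahalanobis_le_norm_sq:
  fixes \<theta> :: "(real ^ 'n) \<times> (real ^ 'n ^ 'n)"
  assumes "\<nu> > 0"
  shows "\<exists>B>0. \<forall>x. \<nu> + mahalanobis \<theta> x \<le> B * (1 + (norm x)\<^sup>2)"
proof -
  let ?K = "matrix_inv (snd \<theta>)"
  define c where "c = onorm ((*v) ?K)"
  have bl: "bounded_linear ((*v) ?K)" by (rule matrix_vector_mul_bounded_linear)
  have c0: "c \<ge> 0" unfolding c_def by (rule onorm_pos_le[OF bl])
  define B where "B = \<nu> + 2 * c * (norm (fst \<theta>))\<^sup>2 + 2 * c"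
  have "\<nu> + mahalanobis \<theta> x \<le> B * (1 + (norm x)\<^sup>2)" for x
  proof -
    let ?y = "x - fst \<theta>"
    have "mahalanobis \<theta> x \<le> norm ?y * norm (?K *v ?y)"
      unfolding mahalanobis_def by (rule norm_cauchy_schwarz)
    also have "\<dots> \<le> norm ?y * (c * norm ?y)"
      unfolding c_def by (intro mult_left_mono onorm[OF bl]) auto
    also have "\<dots> = c * (norm ?y)\<^sup>2" by (simp add: power2_eq_square)
    also have "\<dots> \<le> c * (2 * (norm x)\<^sup>2 + 2 * (norm (fst \<theta>))\<^sup>2)"
    proof (intro mult_left_mono c0)
      have "(norm ?y)\<^sup>2 \<le> (norm x + norm (fst \<theta>))\<^sup>2" by (intro power_mono norm_triangle_ineq4) auto
      also have "\<dots> \<le> 2 * (norm x)\<^sup>2 + 2 * (norm (fst \<theta>))\<^sup>2"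
        using sum_squares_bound[of "norm x" "norm (fst \<theta>)"] by (simp add: power2_sum)
      finally show "(norm ?y)\<^sup>2 \<le> 2 * (norm x)\<^sup>2 + 2 * (norm (fst \<theta>))\<^sup>2" .
    qed
    finally have "\<nu> + mahalanobis \<theta> x \<le> \<nu> + c * (2 * (norm x)\<^sup>2 + 2 * (norm (fst \<theta>))\<^sup>2)" by simp
    also have "\<dots> \<le> B * (1 + (norm x)\<^sup>2)"
    proof -
      have "0 \<le> (\<nu> + 2 * c * (norm (fst \<theta>))\<^sup>2) * (norm x)\<^sup>2" using c0 assms by simp
      then show ?thesis unfolding B_def using c0 by (simp add: algebra_simps)
    qed
    finally show ?thesis .
  qed
  moreover have "B > 0" using assms c0 by (simp add: B_def add_pos_nonneg)
  ultimately show ?thesis by blast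
qed

text \<open>Applied in both directions, it bounds the logarithm of the ratio of two shifted
  distances.\<close>

lemma mahalanobis_ratio_bound:
  fixes \<theta> \<theta>' :: "(real ^ 'n) \<times> (real ^ 'n ^ 'n)"
  assumes "\<theta> \<in> Params" "\<nu> > 0"
  shows "\<exists>B>0. \<forall>x. \<nu> + mahalanobis \<theta>' x \<le> B * (\<nu> + mahalanobis \<theta> x)"
proof -
  obtain B1 B2 where B: "B1 > 0" "B2 > 0" "\<And>x. 1 + (norm x)\<^sup>2 \<le> B1 * (\<nu> + mahalanobis \<theta> x)"
    "\<And>x. \<nu> + mahalanobis \<theta>' x \<le> B2 * (1 + (norm x)\<^sup>2)"
    using norm_sq_le_mahalanobis[OF assms] mahalanobis_le_norm_sq[OF assms(2), of \<theta>'] by blast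
  have "\<nu> + mahalanobis \<theta>' x \<le> (B2 * B1) * (\<nu> + mahalanobis \<theta> x)" for x
    using order_trans[OF B(4) mult_left_mono[OF B(3) less_imp_le[OF B(2)]]] by (simp only: mult.assoc)
  with B(1,2) show ?thesis by (intro exI[of _ "B2 * B1"]) auto
qed

text \<open>Up to the mass \<open>G\<close>, \<open>\<rho>\<close> has mean \<open>\<mu>\<close> and
  covariance \<open>S\<close>, so this is a bias-variance decomposition. Later \<open>Q\<close> is
  the old or the new inverse scale matrix, or \<open>outer y\<close> to test positivity of the new
  scale.\<close>

lemma integral_quadratic_form:
  fixes Q S :: "real ^ 'n ^ 'n" and \<mu> v :: "real ^ 'n" and \<rho> :: "real ^ 'n \<Rightarrow> real"
  assumes int: "integrable M \<rho>" "\<And>i. integrable M (\<lambda>x. \<rho> x * x $ i)"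
      "\<And>i j. integrable M (\<lambda>x. \<rho> x * (x $ i * x $ j))"
    and \<mu>: "\<And>i. (\<integral>x. \<rho> x * x $ i \<partial>M) = G * \<mu> $ i"
    and S: "\<And>i j. (\<integral>x. \<rho> x * (x $ i * x $ j) \<partial>M) = G * (S $ i $ j + \<mu> $ i * \<mu> $ j)"
    and G: "(\<integral>x. \<rho> x \<partial>M) = G" and sym: "transpose S = S"
  shows "integrable M (\<lambda>x. \<rho> x * ((x - v) \<bullet> (Q *v (x - v))))"
    and "(\<integral>x. \<rho> x * ((x - v) \<bullet> (Q *v (x - v))) \<partial>M)
      = G * (trace (Q ** S) + (\<mu> - v) \<bullet> (Q *v (\<mu> - v)))"
proof -
  have q: "y \<bullet> (Q *v y) = (\<Sum>i\<in>UNIV. \<Sum>j\<in>UNIV. Q $ i $ j * (y $ i * y $ j))" for y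
    by (simp add: inner_vec_def matrix_vector_mult_def sum_distrib_left mult_ac)
  have t: "\<rho> x * ((x - v) $ i * (x - v) $ j)
      = \<rho> x * (x $ i * x $ j) - v $ i * (\<rho> x * x $ j) - v $ j * (\<rho> x * x $ i) + v $ i * v $ j * \<rho> x" for x i j
    by (simp add: algebra_simps)
  have I: "integrable M (\<lambda>x. \<rho> x * ((x - v) $ i * (x - v) $ j))" for i j
    unfolding t using int by simp
  have E: "(\<integral>x. \<rho> x * ((x - v) $ i * (x - v) $ j) \<partial>M) = G * (S $ i $ j + (\<mu> - v) $ i * (\<mu> - v) $ j)" for i j
  proof -
    have "(\<integral>x. \<rho> x * ((x - v) $ i * (x - v) $ j) \<partial>M) = G * (S $ i $ j + \<mu> $ i * \<mu> $ j)
        - v $ i * (G * \<mu> $ j) - v $ j * (G * \<mu> $ i) + v $ i * v $ j * G"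
      unfolding t using int by (simp add: \<mu> S G)
    then show ?thesis by (simp add: algebra_simps)
  qed
  have expand: "\<rho> x * ((x - v) \<bullet> (Q *v (x - v)))
      = (\<Sum>i\<in>UNIV. \<Sum>j\<in>UNIV. Q $ i $ j * (\<rho> x * ((x - v) $ i * (x - v) $ j)))" for x
    unfolding q by (simp only: sum_distrib_left mult_ac)
  show "integrable M (\<lambda>x. \<rho> x * ((x - v) \<bullet> (Q *v (x - v))))"
    unfolding expand by (intro Bochner_Integration.integrable_sum integrable_mult_right I)
  have "(\<integral>x. \<rho> x * ((x - v) \<bullet> (Q *v (x - v))) \<partial>M)
      = (\<Sum>i\<in>UNIV. \<Sum>j\<in>UNIV. Q $ i $ j * (G * (S $ i $ j + (\<mu> - v) $ i * (\<mu> - v) $ j)))"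
    unfolding expand
    by (simp only: Bochner_Integration.integral_sum Bochner_Integration.integrable_sum
        integrable_mult_right I integral_mult_right_zero E)
  also have "\<dots> = G * ((\<Sum>i\<in>UNIV. \<Sum>j\<in>UNIV. Q $ i $ j * S $ i $ j) + (\<mu> - v) \<bullet> (Q *v (\<mu> - v)))"
    unfolding q by (simp add: sum_distrib_left sum.distrib[symmetric] algebra_simps)
  also have "(\<Sum>i\<in>UNIV. \<Sum>j\<in>UNIV. Q $ i $ j * S $ i $ j) = trace (Q ** S)"
  proof -
    have "S $ i $ j = S $ j $ i" for i j using sym by (metis transpose_def vec_lambda_beta)
    then show ?thesis by (simp add: trace_def matrix_matrix_mult_def)
  qed
  finally show "(\<integral>x. \<rho> x * ((x - v) \<bullet> (Q *v (x - v))) \<partial>M)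
      = G * (trace (Q ** S) + (\<mu> - v) \<bullet> (Q *v (\<mu> - v)))" .
qed

section \<open>Strict log-determinant estimate\<close>

lemma det_scaleR:
  fixes A :: "real ^ 'n ^ 'n"
  shows "det (c *\<^sub>R A) = c ^ CARD('n) * det A"
proof -
  have "c *\<^sub>R A = (\<chi> i. c *s A $ i)" by (simp add: vec_eq_iff)
  then show ?thesis using det_rows_mul[of "\<lambda>_. c" "\<lambda>i. A $ i"] by simp
qed

lemma log_det_decrease:
  fixes S S' :: "real ^ 'n ^ 'n" and \<mu> \<mu>' :: "real ^ 'n"
  assumes spd: "spd S" "spd S'" and "\<nu> > 0" "g > 0"
    and g: "g * (\<nu> + (trace (matrix_inv S ** S') + (\<mu>' - \<mu>) \<bullet> (matrix_inv S *v (\<mu>' - \<mu>)))) = \<nu> + real CARD('n)"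
    and neq: "(\<mu>', S') \<noteq> (\<mu>, S)"
  shows "ln (det S') - ln (det S) + (\<nu> + real CARD('n)) * ln g < 0"
proof -
  let ?d = "real CARD('n)" and ?\<delta> = "(\<mu>' - \<mu>) \<bullet> (matrix_inv S *v (\<mu>' - \<mu>))"
  note spdK = spd_matrix_inv[OF spd(1)]
  obtain R :: "real ^ 'n ^ 'n" where R: "invertible R" "matrix_inv S = transpose R ** R"
    using spd_factorization[OF spdK] by blast
  \<comment> \<open>\<open>matrix_inv S ** S'\<close> need not be symmetric; conjugation by
    \<open>R\<close> turns it into a positive definite matrix with the same trace and
    determinant.\<close>
  let ?C = "R ** S' ** transpose R"
  have invT: "invertible (transpose R)" using R(1) by (simp add: invertible_det_nz)
  have C: "spd ?C" using spd_congruence[OF spd(2) invT] by simp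
  have pos: "det S > 0" "det S' > 0" "det ?C > 0" using spd C by (auto intro: det_spd_pos)
  have detR: "det R * det R = 1 / det S"
    using arg_cong[OF R(2), of det] by (simp add: det_mul det_matrix_inv[OF spd_invertible[OF spd(1)]])
  have "det ?C = (det R * det R) * det S'" by (simp add: det_mul mult_ac)
  also have "\<dots> = det S' / det S" unfolding detR by simp
  finally have "det ?C = det S' / det S" .
  then have lnC: "ln (det ?C) = ln (det S') - ln (det S)"
    using pos by (simp add: ln_div)
  have trC: "trace (matrix_inv S ** S') = trace ?C"
    unfolding R(2) by (metis matrix_mul_assoc trace_mul_sym)
  \<comment> \<open>Scaling by \<open>g\<close> lets the trace inequality account for the
    dimension's share of \<open>ln g\<close>.\<close>
  let ?D = "g *\<^sub>R ?C"
  have D: "spd ?D"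
    using C \<open>g > 0\<close> by (auto simp: spd_def transpose_def vec_eq_iff scaleR_matrix_vector_assoc[symmetric])
  have lnD: "ln (det ?D) = ?d * ln g + ln (det ?C)"
    using pos \<open>g > 0\<close> by (simp add: det_scaleR ln_mult ln_realpow)
  have trD: "trace ?D = g * trace ?C" by (simp add: trace_def sum_distrib_left)
  have \<delta>: "?\<delta> \<ge> 0" by (rule spd_nonneg[OF spdK])
  have lng: "ln g \<le> g - 1" using \<open>g > 0\<close> by (rule ln_le_minus_one)
  note D_le = ln_det_le_trace[OF D, unfolded lnD trD]
  \<comment> \<open>The upper bounds for the two logarithmic terms add up to exactly this
    non-positive amount.\<close>
  have eq: "\<nu> * (g - 1) + (g * trace ?C - ?d) = - (g * ?\<delta>)"
    using g unfolding trC by (simp add: algebra_simps)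
  have g\<delta>: "g * ?\<delta> \<ge> 0" using \<delta> \<open>g > 0\<close> by simp
  have \<nu>g: "\<nu> * ln g \<le> \<nu> * (g - 1)" using lng \<open>\<nu> > 0\<close> by simp
  have sum: "ln (det S') - ln (det S) + (\<nu> + ?d) * ln g = \<nu> * ln g + (?d * ln g + ln (det ?C))"
    by (simp add: lnC algebra_simps)
  show ?thesis
  proof (rule ccontr)
    assume "\<not> ?thesis"
    with sum have ge: "0 \<le> \<nu> * ln g + (?d * ln g + ln (det ?C))" by linarith
    have le: "?d * ln g + ln (det ?C) \<le> g * trace ?C - ?d" using D_le by linarith
    \<comment> \<open>A non-negative total squeezes the whole chain, so each inequality in it can be
      read off as an equality.\<close>
    have "g * ?\<delta> = 0" using ge le eq g\<delta> \<nu>g by linarith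
    then have "\<mu>' - \<mu> = 0" using \<open>g > 0\<close> spd_pos[OF spdK, of "\<mu>' - \<mu>"] by force
    have "\<nu> * ln g = \<nu> * (g - 1)" using ge le eq g\<delta> \<nu>g by linarith
    then have "g = 1" using \<open>\<nu> > 0\<close> \<open>g > 0\<close> ln_eq_minus_one by simp
    have "g * trace ?C - (?d * ln g + ln (det ?C)) \<le> ?d" using ge le eq g\<delta> \<nu>g by linarith
    with D_le have "?D = mat 1" by blast
    with \<open>g = 1\<close> have C1: "R ** S' ** transpose R = mat 1" by simp
    then have "transpose R ** (R ** S') = mat 1"
      by (simp add: matrix_left_right_inverse)
    then have "matrix_inv S ** S' = mat 1" by (simp add: R(2) matrix_mul_assoc)
    then have "S ** (matrix_inv S ** S') = S" by simp
    then have "S' = S" by (simp add: matrix_mul_assoc matrix_inv_mult[OF spd_invertible[OF spd(1)]])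
    with \<open>\<mu>' - \<mu> = 0\<close> neq show False by simp
  qed
qed

section \<open>One step of the algorithm\<close>

lemma
  fixes \<theta> :: "(real ^ 'n) \<times> (real ^ 'n ^ 'n)"
  assumes "\<nu> > 0" "\<theta> \<in> Params"
  shows student_pos: "0 < student \<nu> \<theta> x"
    and integrable_student: "integrable lebesgue (student \<nu> \<theta>)"
    and integral_student: "(\<integral>x. student \<nu> \<theta> x \<partial>lebesgue) = 1"
proof -
  obtain c where c: "c > 0" "integrable lebesgue (student_kernel \<nu> \<theta>)"
    "(\<integral>x. student_kernel \<nu> \<theta> x \<partial>lebesgue) = sqrt (det (snd \<theta>)) * c"
    using student_normalizer[where 'n = 'n, OF assms(1)] assms(2) by metis
  have "det (snd \<theta>) > 0" using assms(2) det_spd_pos by (auto simp: Params_def)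
  then have I: "(\<integral>x. student_kernel \<nu> \<theta> x \<partial>lebesgue) > 0" using c by simp
  show "0 < student \<nu> \<theta> x" using student_kernel_pos[OF assms] I by (simp add: student_def)
  show "integrable lebesgue (student \<nu> \<theta>)" using c(2) by (simp add: student_def[abs_def])
  show "(\<integral>x. student \<nu> \<theta> x \<partial>lebesgue) = 1" using I by (simp add: student_def)
qed

text \<open>The common constant \<open>c\<close> and the powers of \<open>\<nu>\<close> cancel,
  leaving the determinants and the shifted distances.\<close>

lemma ln_student_ratio:
  fixes \<theta> \<theta>' :: "(real ^ 'n) \<times> (real ^ 'n ^ 'n)"
  assumes "\<nu> > 0" and \<theta>: "\<theta> \<in> Params" and \<theta>': "\<theta>' \<in> Params"
  shows "ln (student \<nu> \<theta> x / student \<nu> \<theta>' x) = (ln (det (snd \<theta>')) - ln (det (snd \<theta>))) / 2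
    + (\<nu> + real CARD('n)) / 2 * ln ((\<nu> + mahalanobis \<theta>' x) / (\<nu> + mahalanobis \<theta> x))"
proof -
  obtain c where c: "c > 0" "\<And>\<theta> :: (real ^ 'n) \<times> (real ^ 'n ^ 'n). \<theta> \<in> Params \<Longrightarrow>
       (\<integral>x. student_kernel \<nu> \<theta> x \<partial>lebesgue) = sqrt (det (snd \<theta>)) * c"
    using student_normalizer[where 'n = 'n, OF assms(1)] by metis
  have ln1: "ln (student \<nu> \<theta> x) = - ((\<nu> + real CARD('n)) / 2) * (ln (\<nu> + mahalanobis \<theta> x) - ln \<nu>)
      - ln (det (snd \<theta>)) / 2 - ln c" if \<theta>: "\<theta> \<in> Params" for \<theta> :: "(real ^ 'n) \<times> (real ^ 'n ^ 'n)"
  proof -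
    have det: "det (snd \<theta>) > 0" using \<theta> det_spd_pos by (auto simp: Params_def)
    have a: "\<nu> + mahalanobis \<theta> x > 0" using mahalanobis_nonneg[OF \<theta>, of x] assms(1) by simp
    have "1 + 1 / \<nu> * mahalanobis \<theta> x = (\<nu> + mahalanobis \<theta> x) / \<nu>"
      using assms(1) by (simp add: field_simps)
    then have "ln (student_kernel \<nu> \<theta> x) = - ((\<nu> + real CARD('n)) / 2) * (ln (\<nu> + mahalanobis \<theta> x) - ln \<nu>)"
      using a assms(1) by (simp add: student_kernel_def ln_powr ln_div)
    then show ?thesis
      using student_kernel_pos[OF assms(1) \<theta>, of x] det c(1)
      by (simp add: student_def c(2)[OF \<theta>] ln_div ln_mult ln_sqrt)
  qed
  have "ln ((\<nu> + mahalanobis \<theta>' x) / (\<nu> + mahalanobis \<theta> x))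
      = ln (\<nu> + mahalanobis \<theta>' x) - ln (\<nu> + mahalanobis \<theta> x)"
    using mahalanobis_nonneg[OF \<theta>, of x] mahalanobis_nonneg[OF \<theta>', of x] assms(1) by (intro ln_divide_pos) auto
  moreover have "ln (student \<nu> \<theta> x / student \<nu> \<theta>' x) = ln (student \<nu> \<theta> x) - ln (student \<nu> \<theta>' x)"
    using student_pos[OF assms(1) \<theta>, of x] student_pos[OF assms(1) \<theta>', of x] by (intro ln_divide_pos) auto
  ultimately show ?thesis
    by (simp only: ln1[OF \<theta>] ln1[OF \<theta>']) (simp add: field_simps)
qed

text \<open>Membership in \<open>Params\<close> lets the step be iterated, and the second claim
  relies on it for the new Student density.\<close>

lemma ml_step_decrease:
  fixes f :: "real ^ 'n \<Rightarrow> real" and w :: "real \<Rightarrow> real" and \<nu> :: real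
    and \<theta> :: "(real ^ 'n) \<times> (real ^ 'n ^ 'n)"
  assumes \<nu>: "\<nu> > 0" and f: "f \<in> borel_measurable lebesgue"
    and nonneg: "\<And>u. u \<in> {0..1} \<Longrightarrow> w u \<ge> 0"
    and w: "antimono_on {0..1} w" and pos: "integral {0..1} w > 0"
    and \<theta>: "\<theta> \<in> Params"
  defines "\<theta>' \<equiv> ml_step \<nu> w f \<theta>" and "\<pi> \<equiv> target w f (student \<nu> \<theta>)"
  shows "\<theta>' \<in> Params"
    and "\<exists>\<Delta>::real. KL \<pi> (student \<nu> \<theta>') + ereal \<Delta> \<le> KL \<pi> (student \<nu> \<theta>)
      \<and> (if \<theta>' = \<theta> then \<Delta> = 0 else \<Delta> > 0)"
proof -
  let ?d = "real CARD('n)" and ?p = "student \<nu> \<theta>"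
  define a where "a x = \<nu> + mahalanobis \<theta> x" for x
  define \<gamma> where "\<gamma> = gam \<nu> \<theta>"
  note pp = student_pos[OF \<nu> \<theta>] and pint = integrable_student[OF \<nu> \<theta>]
  obtain r C where r: "r \<in> borel_measurable lebesgue" "\<And>x. 0 \<le> r x" "\<And>x. r x \<le> C"
    and \<pi>: "\<pi> = (\<lambda>x. r x * ?p x)" and m: "0 < (\<integral>x. r x * ?p x \<partial>lebesgue)"
    unfolding \<pi>_def
    using target_bounds[OF less_imp_le[OF pp] pint integral_student[OF \<nu> \<theta>] f nonneg w pos] by blast
  define m where "m = (\<integral>x. \<pi> x \<partial>lebesgue)"
  have m0: "m > 0" using m by (simp add: m_def \<pi>)
  have \<pi>0: "0 \<le> \<pi> x" for x unfolding \<pi> by (intro mult_nonneg_nonneg r less_imp_le[OF pp])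
  \<comment> \<open>A Bochner integral defaults to 0 on non-integrable functions, so a positive
    value proves integrability.\<close>
  have \<pi>int: "integrable lebesgue \<pi>"
    using m not_integrable_integral_eq unfolding \<pi> by fastforce
  have a0: "0 < a x" "\<nu> \<le> a x" for x using mahalanobis_nonneg[OF \<theta>, of x] \<nu> by (simp_all add: a_def)
  have am: "a \<in> borel_measurable lebesgue"
    unfolding a_def by (intro borel_measurable_add borel_measurable_const measurable_completion) simp
  have \<gamma>: "\<gamma> x = (\<nu> + ?d) / a x" for x by (simp add: \<gamma>_def gam_def a_def)
  have \<gamma>0: "0 < \<gamma> x" for x using a0 \<nu> by (simp add: \<gamma> add_pos_nonneg)
  have \<gamma>m: "\<gamma> \<in> borel_measurable lebesgue" unfolding \<gamma> using am by measurable
  have bdd_int: "integrable lebesgue (\<lambda>x. \<pi> x * h x)"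
    if h: "h \<in> borel_measurable lebesgue" "\<And>x. \<bar>h x\<bar> \<le> B" for h B
  proof (rule Bochner_Integration.integrable_bound[of lebesgue "\<lambda>x. B * \<pi> x"])
    show "integrable lebesgue (\<lambda>x. B * \<pi> x)" using \<pi>int by simp
    show "(\<lambda>x. \<pi> x * h x) \<in> borel_measurable lebesgue" using h(1) \<pi>int by measurable
    show "AE x in lebesgue. norm (\<pi> x * h x) \<le> norm (B * \<pi> x)"
    proof (rule AE_I2)
      fix x
      have "\<bar>\<pi> x * h x\<bar> = \<pi> x * \<bar>h x\<bar>" using \<pi>0 by (simp add: abs_mult)
      also have "\<dots> \<le> \<pi> x * B" using h(2) \<pi>0 by (intro mult_left_mono)
      finally show "norm (\<pi> x * h x) \<le> norm (B * \<pi> x)" by (simp add: mult.commute)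
    qed
  qed
  obtain B where B: "B > 0" "\<And>x. 1 + (norm x)\<^sup>2 \<le> B * a x"
    using norm_sq_le_mahalanobis[OF \<theta> \<nu>] unfolding a_def by blast
  \<comment> \<open>The denominator of \<open>\<gamma>\<close> cancels quadratic growth; this gives
    all the moments needed for the update.\<close>
  have \<gamma>B: "\<gamma> x * y \<le> (\<nu> + ?d) * B" if "y \<le> 1 + (norm x)\<^sup>2" for x y
  proof -
    have "\<gamma> x * y \<le> \<gamma> x * (B * a x)"
      using order_trans[OF that B(2)] \<gamma>0[of x] by (intro mult_left_mono) auto
    also have "\<dots> = (\<nu> + ?d) * B" using a0(1)[of x] by (simp add: \<gamma>)
    finally show ?thesis .
  qed
  have \<gamma>abs: "\<bar>\<gamma> x * y\<bar> \<le> (\<nu> + ?d) * B" if "\<bar>y\<bar> \<le> 1 + (norm x)\<^sup>2" for x y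
    using \<gamma>B[OF that] \<gamma>0[of x] by (simp add: abs_mult)
  have nx: "norm x \<le> 1 + (norm x)\<^sup>2" for x :: "real ^ 'n"
    by (rule order_trans[of _ "2 * norm x"]) (use sum_squares_bound[of 1 "norm x"] in simp_all)
  have coord: "(\<lambda>x :: real ^ 'n. x $ i) \<in> borel_measurable lebesgue" for i
    by (intro measurable_completion) simp
  \<comment> \<open>The update takes the mean and the covariance of this density after normalisation
    by its mass \<open>G\<close>.\<close>
  define \<rho> where "\<rho> x = \<pi> x * \<gamma> x" for x
  have int0: "integrable lebesgue \<rho>"
    unfolding \<rho>_def using \<gamma>abs[of 1] by (intro bdd_int[OF \<gamma>m]) simp
  have int1: "integrable lebesgue (\<lambda>x. \<rho> x * x $ i)" for i
    unfolding \<rho>_def mult.assoc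
  proof (rule bdd_int)
    show "(\<lambda>x. \<gamma> x * x $ i) \<in> borel_measurable lebesgue" using \<gamma>m coord by measurable
    show "\<bar>\<gamma> x * x $ i\<bar> \<le> (\<nu> + ?d) * B" for x
      by (intro \<gamma>abs order_trans[OF component_le_norm_cart nx])
  qed
  have int2: "integrable lebesgue (\<lambda>x. \<rho> x * (x $ i * x $ j))" for i j
    unfolding \<rho>_def mult.assoc[of "\<pi> _"]
  proof (rule bdd_int)
    show "(\<lambda>x. \<gamma> x * (x $ i * x $ j)) \<in> borel_measurable lebesgue" using \<gamma>m coord by measurable
    show "\<bar>\<gamma> x * (x $ i * x $ j)\<bar> \<le> (\<nu> + ?d) * B" for x
    proof (rule \<gamma>abs)
      have "\<bar>x $ i * x $ j\<bar> \<le> norm x * norm x"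
        unfolding abs_mult by (intro mult_mono component_le_norm_cart) auto
      then show "\<bar>x $ i * x $ j\<bar> \<le> 1 + (norm x)\<^sup>2" by (simp add: power2_eq_square)
    qed
  qed
  have law_int: "(\<integral>x. h x \<partial>law \<pi>) = (\<integral>x. \<pi> x *\<^sub>R h x \<partial>lebesgue)"
    if "h \<in> borel_measurable lebesgue" for h :: "real ^ 'n \<Rightarrow> 'z :: {banach, second_countable_topology}"
    unfolding law_def using \<pi>0 \<pi>int by (intro integral_density that) auto
  define G where "G = (\<integral>x. \<rho> x \<partial>lebesgue)"
  have \<rho>0: "0 \<le> \<rho> x" for x unfolding \<rho>_def by (intro mult_nonneg_nonneg \<pi>0 less_imp_le[OF \<gamma>0])
  have \<rho>_null: False if "AE x in lebesgue. \<rho> x = 0"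
  proof -
    have "AE x in lebesgue. \<pi> x = 0"
      using that by eventually_elim (use \<gamma>0 in \<open>auto simp: \<rho>_def less_le\<close>)
    then have "m = 0" unfolding m_def by (rule integral_eq_zero_AE)
    with m0 show False by simp
  qed
  have G0: "G > 0"
    using \<rho>_null integral_nonneg_eq_0_iff_AE[OF int0] \<rho>0 Bochner_Integration.integral_nonneg[of lebesgue \<rho>]
    unfolding G_def by (auto simp: less_le)
  define \<mu>' where "\<mu>' = fst \<theta>'"
  define S' where "S' = snd \<theta>'"
  have idm: "(\<lambda>x :: real ^ 'n. x) \<in> borel_measurable lebesgue"
    by (intro measurable_completion) simp
  have outm: "(outer :: real ^ 'n \<Rightarrow> _) \<in> borel_measurable lebesgue"
  proof -
    have "continuous_on UNIV (outer :: real ^ 'n \<Rightarrow> _)"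
      unfolding outer_def[abs_def] by (intro continuous_on_vec_lambda continuous_intros)
    then show ?thesis by (intro measurable_completion) (simp add: borel_measurable_continuous_onI)
  qed
  have G_law: "(\<integral>x. \<gamma> x \<partial>law \<pi>) = G"
    using law_int[OF \<gamma>m] by (simp add: G_def \<rho>_def)
  have step: "\<mu>' = (1 / G) *\<^sub>R (\<integral>x. \<gamma> x *\<^sub>R x \<partial>law \<pi>)"
      "S' = (1 / G) *\<^sub>R (\<integral>x. \<gamma> x *\<^sub>R outer x \<partial>law \<pi>) - outer \<mu>'"
    by (simp_all add: \<mu>'_def S'_def \<theta>'_def ml_step_def Let_def \<pi>_def[symmetric] \<gamma>_def[symmetric] G_law)
  have mu: "(\<integral>x. \<rho> x * x $ i \<partial>lebesgue) = G * \<mu>' $ i" for i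
  proof -
    have "(\<integral>x. \<gamma> x *\<^sub>R x \<partial>law \<pi>) = (\<integral>x. \<rho> x *\<^sub>R x \<partial>lebesgue)"
      by (subst law_int) (use \<gamma>m idm in \<open>auto simp: \<rho>_def\<close>)
    also have "\<dots> $ i = (\<integral>x. \<rho> x * x $ i \<partial>lebesgue)"
      by (subst integral_vec_nth) (auto simp: int1)
    finally show ?thesis using G0 by (simp add: step(1))
  qed
  have sig: "(\<integral>x. \<rho> x * (x $ i * x $ j) \<partial>lebesgue) = G * (S' $ i $ j + \<mu>' $ i * \<mu>' $ j)" for i j
  proof -
    have out: "(\<rho> x *\<^sub>R outer x) $ i $ j = \<rho> x * (x $ i * x $ j)" for x i j by (simp add: outer_def)
    have "integrable lebesgue (\<lambda>x. (\<rho> x *\<^sub>R outer x) $ i)" for i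
      by (rule integrable_vec) (simp only: out int2)
    then have "(\<integral>x. \<rho> x *\<^sub>R outer x \<partial>lebesgue) $ i $ j = (\<integral>x. \<rho> x * (x $ i * x $ j) \<partial>lebesgue)"
      by (subst integral_vec_nth, assumption, subst integral_vec_nth) (simp_all only: out int2)
    moreover have "(\<integral>x. \<gamma> x *\<^sub>R outer x \<partial>law \<pi>) = (\<integral>x. \<rho> x *\<^sub>R outer x \<partial>lebesgue)"
      by (subst law_int) (use \<gamma>m outm in \<open>auto simp: \<rho>_def\<close>)
    ultimately have "S' $ i $ j = 1 / G * (\<integral>x. \<rho> x * (x $ i * x $ j) \<partial>lebesgue) - \<mu>' $ i * \<mu>' $ j"
      by (simp add: step(2) outer_def)
    then show ?thesis using G0 by simp
  qed
  have sym: "transpose S' = S'"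
  proof -
    have "G * S' $ i $ j = G * S' $ j $ i" for i j
      using sig[of i j] sig[of j i] by (simp add: algebra_simps)
    then show ?thesis using G0 by (simp add: transpose_def vec_eq_iff)
  qed
  note quad = integral_quadratic_form[OF int0 int1 int2 mu sig G_def[symmetric] sym]
  \<comment> \<open>\<open>outer y\<close> extracts the variance in direction \<open>y\<close>. Were
    it zero, \<open>\<rho>\<close> would live on a hyperplane, a null set, and vanish almost
    everywhere.\<close>
  have "spd S'"
    unfolding spd_def
  proof (intro conjI allI impI sym)
    fix y :: "real ^ 'n" assume y: "y \<noteq> 0"
    have oy: "z \<bullet> (outer y *v z) = (y \<bullet> z)\<^sup>2" for z
      by (simp add: inner_vec_def matrix_vector_mult_def outer_def power2_eq_square sum_product sum_distrib_left mult_ac)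
    have ty: "trace (outer y ** S') = y \<bullet> (S' *v y)"
      using sym by (simp add: trace_def matrix_matrix_mult_def inner_vec_def matrix_vector_mult_def outer_def
          sum_distrib_left mult_ac transpose_def vec_eq_iff)
    have E: "(\<integral>x. \<rho> x * (y \<bullet> (x - \<mu>'))\<^sup>2 \<partial>lebesgue) = G * (y \<bullet> (S' *v y))"
      using quad(2)[of \<mu>' "outer y"] by (simp add: oy ty)
    have I: "integrable lebesgue (\<lambda>x. \<rho> x * (y \<bullet> (x - \<mu>'))\<^sup>2)"
      using quad(1)[of \<mu>' "outer y"] by (simp add: oy)
    have "0 \<le> (\<integral>x. \<rho> x * (y \<bullet> (x - \<mu>'))\<^sup>2 \<partial>lebesgue)" using \<rho>0 by simp
    moreover have "(\<integral>x. \<rho> x * (y \<bullet> (x - \<mu>'))\<^sup>2 \<partial>lebesgue) \<noteq> 0"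
    proof
      assume "(\<integral>x. \<rho> x * (y \<bullet> (x - \<mu>'))\<^sup>2 \<partial>lebesgue) = 0"
      then have "AE x in lebesgue. \<rho> x * (y \<bullet> (x - \<mu>'))\<^sup>2 = 0"
        using \<rho>0 by (subst (asm) integral_nonneg_eq_0_iff_AE[OF I]) auto
      moreover have "{x. y \<bullet> x = y \<bullet> \<mu>'} \<in> null_sets lebesgue"
        using negligible_hyperplane[of y "y \<bullet> \<mu>'"] y by (simp add: negligible_iff_null_sets)
      then have "AE x in lebesgue. x \<notin> {x. y \<bullet> x = y \<bullet> \<mu>'}" by (rule AE_not_in)
      ultimately have "AE x in lebesgue. \<rho> x = 0"
        by eventually_elim (auto simp: inner_diff_right)
      then show False by (rule \<rho>_null)
    qed
    ultimately have "0 < G * (y \<bullet> (S' *v y))" unfolding E by linarith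
    then show "0 < y \<bullet> (S' *v y)" using G0 by (simp add: zero_less_mult_iff)
  qed
  then show \<theta>': "\<theta>' \<in> Params" by (auto simp: Params_def S'_def split: prod.split)

  define a' where "a' x = \<nu> + mahalanobis \<theta>' x" for x
  have a'0: "0 < a' x" for x using mahalanobis_nonneg[OF \<theta>', of x] \<nu> by (simp add: a'_def)
  have a'm: "a' \<in> borel_measurable lebesgue"
    unfolding a'_def by (intro borel_measurable_add borel_measurable_const measurable_completion) simp
  define K where "K = (\<lambda>x. ln (\<pi> x / ?p x) * \<pi> x)"
  have KL0: "K x = (r x * ln (r x)) * ?p x" for x
    using pp[of x] by (simp add: K_def \<pi> less_imp_neq[symmetric])
  have Kint: "integrable lebesgue K"
  proof (rule Bochner_Integration.integrable_bound[of lebesgue "\<lambda>x. (1 + C\<^sup>2) * ?p x"])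
    show "integrable lebesgue (\<lambda>x. (1 + C\<^sup>2) * ?p x)" using pint by simp
    show "K \<in> borel_measurable lebesgue" unfolding KL0 using r(1) pint by measurable
    show "AE x in lebesgue. norm (K x) \<le> norm ((1 + C\<^sup>2) * ?p x)"
    proof (rule AE_I2)
      fix x
      have "norm (K x) = \<bar>r x * ln (r x)\<bar> * ?p x" using pp[of x] by (simp add: KL0 abs_mult)
      also have "\<dots> \<le> (1 + C\<^sup>2) * ?p x"
        using pp[of x] by (intro mult_right_mono abs_mult_ln_le r) auto
      finally show "norm (K x) \<le> norm ((1 + C\<^sup>2) * ?p x)" by simp
    qed
  qed
  have KL\<theta>: "KL \<pi> ?p = ereal (\<integral>x. K x \<partial>lebesgue)"
    using KL_eq_integral[of \<pi> ?p] Kint by (simp add: K_def)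
  define l where "l x = ln (a' x / a x)" for x
  have lm: "l \<in> borel_measurable lebesgue" unfolding l_def using am a'm by measurable
  obtain B1 B2 where B12: "B1 > 0" "B2 > 0" "\<And>x. a' x \<le> B1 * a x" "\<And>x. a x \<le> B2 * a' x"
    using mahalanobis_ratio_bound[OF \<theta> \<nu>, of \<theta>'] mahalanobis_ratio_bound[OF \<theta>' \<nu>, of \<theta>]
    unfolding a_def a'_def by blast
  have lb: "\<bar>l x\<bar> \<le> \<bar>ln B1\<bar> + \<bar>ln B2\<bar>" for x
  proof -
    have "ln (a' x) \<le> ln (B1 * a x)" "ln (a x) \<le> ln (B2 * a' x)"
      using B12 a0(1)[of x] a'0[of x] by (simp_all add: ln_mono)
    then show ?thesis
      using B12(1,2) a0(1)[of x] a'0[of x] by (simp add: l_def ln_divide_pos ln_mult_pos)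
  qed
  have lint: "integrable lebesgue (\<lambda>x. \<pi> x * l x)" by (rule bdd_int[OF lm lb])
  let ?D = "ln (det S') - ln (det (snd \<theta>))"
  \<comment> \<open>The chain rule for the logarithm of the density ratio; where
    \<open>\<pi>\<close> vanishes, the factor \<open>\<pi> x\<close> makes both sides 0.\<close>
  have split: "ln (\<pi> x / student \<nu> \<theta>' x) * \<pi> x = K x + (?D / 2 * \<pi> x + (\<nu> + ?d) / 2 * (\<pi> x * l x))" for x
  proof (cases "\<pi> x = 0")
    case False
    then have \<pi>x: "\<pi> x > 0" using \<pi>0[of x] by simp
    have "ln (\<pi> x / student \<nu> \<theta>' x) = ln (\<pi> x / ?p x) + ln (?p x / student \<nu> \<theta>' x)"
      using \<pi>x pp[of x] student_pos[OF \<nu> \<theta>', of x] by (simp add: ln_divide_pos)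
    also have "ln (?p x / student \<nu> \<theta>' x) = ?D / 2 + (\<nu> + ?d) / 2 * l x"
      unfolding ln_student_ratio[OF \<nu> \<theta> \<theta>'] by (simp add: S'_def l_def a_def a'_def)
    finally show ?thesis by (simp add: K_def algebra_simps)
  qed (simp add: K_def)
  define L where "L = (\<integral>x. \<pi> x * l x \<partial>lebesgue)"
  have "integrable lebesgue (\<lambda>x. ln (\<pi> x / student \<nu> \<theta>' x) * \<pi> x)"
    unfolding split using Kint lint \<pi>int by simp
  from KL_eq_integral[OF this] have KL\<theta>': "KL \<pi> (student \<nu> \<theta>')
      = ereal ((\<integral>x. K x \<partial>lebesgue) + (?D / 2 * m + (\<nu> + ?d) / 2 * L))"
    unfolding split using Kint lint \<pi>int by (simp add: m_def L_def)
  \<comment> \<open>Division by the mass \<open>m\<close> makes this the mean of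
    \<open>\<gamma>\<close> under the normalised target.\<close>
  define g where "g = G / m"
  have g0: "g > 0" using G0 m0 by (simp add: g_def)
  have mahal: "mahalanobis \<theta> x = (x - fst \<theta>) \<bullet> (matrix_inv (snd \<theta>) *v (x - fst \<theta>))"
    "mahalanobis \<theta>' x = (x - \<mu>') \<bullet> (matrix_inv S' *v (x - \<mu>'))" for x
    by (simp_all add: mahalanobis_def \<mu>'_def S'_def)
  let ?t = "trace (matrix_inv (snd \<theta>) ** S') + (\<mu>' - fst \<theta>) \<bullet> (matrix_inv (snd \<theta>) *v (\<mu>' - fst \<theta>))"
  \<comment> \<open>The constraint on \<open>g\<close> arises by integrating the identity
    \<open>\<gamma> x * a x = \<nu> + d\<close> against the target.\<close>
  have "(\<nu> + ?d) * m = (\<integral>x. \<rho> x * a x \<partial>lebesgue)"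
    using a0(1) by (simp add: m_def \<rho>_def \<gamma> less_imp_neq[symmetric] mult.commute)
  also have "\<dots> = (\<integral>x. \<nu> * \<rho> x + \<rho> x * mahalanobis \<theta> x \<partial>lebesgue)"
    by (simp add: a_def algebra_simps)
  also have "\<dots> = \<nu> * G + G * ?t"
    unfolding mahal using quad[of "fst \<theta>" "matrix_inv (snd \<theta>)"] int0 by (simp add: G_def[symmetric])
  finally have g_eq: "g * (\<nu> + ?t) = \<nu> + ?d" using m0 by (simp add: g_def field_simps)
  \<comment> \<open>At the new parameter the displacement is 0 and the trace is the dimension, so
    the normalised mean of \<open>a' / a\<close> is \<open>g\<close>.\<close>
  have a'int: "integrable lebesgue (\<lambda>x. \<rho> x * a' x)"
    and a'val: "(\<integral>x. \<rho> x * a' x \<partial>lebesgue) = G * (\<nu> + ?d)"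
  proof -
    have e: "\<rho> x * a' x = \<nu> * \<rho> x + \<rho> x * mahalanobis \<theta>' x" for x by (simp add: a'_def algebra_simps)
    have "trace (matrix_inv S' ** S') = ?d"
      using matrix_inv_mult(2)[OF spd_invertible[OF \<open>spd S'\<close>]] by (simp add: trace_I)
    then show "integrable lebesgue (\<lambda>x. \<rho> x * a' x)" "(\<integral>x. \<rho> x * a' x \<partial>lebesgue) = G * (\<nu> + ?d)"
      unfolding e mahal using quad[of \<mu>' "matrix_inv S'"] int0
      by (simp_all add: G_def[symmetric] distrib_left mult.commute[of \<nu> G])
  qed
  have N0: "\<nu> + ?d \<noteq> 0" using \<nu> by (simp add: add_pos_nonneg less_imp_neq[symmetric])
  \<comment> \<open>Jensen's inequality in tangent form: the logarithm lies below its tangent at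
    \<open>g\<close>, and integrating the tangent uses only that mean.\<close>
  have "L \<le> (\<integral>x. (ln g - 1) * \<pi> x + 1 / (g * (\<nu> + ?d)) * (\<rho> x * a' x) \<partial>lebesgue)"
    unfolding L_def
  proof (rule integral_mono)
    fix x
    have "l x - ln g = ln (a' x / a x / g)"
      using a0(1)[of x] a'0[of x] g0 by (simp add: l_def ln_divide_pos ln_mult_pos)
    also have "\<dots> \<le> a' x / a x / g - 1"
      using a0(1)[of x] a'0[of x] g0 by (intro ln_le_minus_one) simp
    finally have "l x \<le> (ln g - 1) + a' x / a x / g" by simp
    from mult_left_mono[OF this \<pi>0] have "\<pi> x * l x \<le> (ln g - 1) * \<pi> x + \<pi> x * (a' x / a x / g)"
      by (simp add: algebra_simps)
    also have "\<pi> x * (a' x / a x / g) = 1 / (g * (\<nu> + ?d)) * (\<rho> x * a' x)"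
    proof -
      have "u * (A / b / g) = 1 / (g * N) * (u * (N / b) * A)" if "N \<noteq> 0" for u A b N :: real
        using that by simp
      from this[OF N0] show ?thesis by (simp only: \<rho>_def \<gamma>)
    qed
    finally show "\<pi> x * l x \<le> (ln g - 1) * \<pi> x + 1 / (g * (\<nu> + ?d)) * (\<rho> x * a' x)" .
  qed (use lint \<pi>int a'int in auto)
  also have "\<dots> = (ln g - 1) * m + 1 / (g * (\<nu> + ?d)) * (G * (\<nu> + ?d))"
    using \<pi>int a'int by (simp add: m_def a'val)
  also have "1 / (g * (\<nu> + ?d)) * (G * (\<nu> + ?d)) = m"
    using N0 G0 m0 by (simp add: g_def)
  finally have L: "L \<le> m * ln g" by (simp add: algebra_simps)
  show "\<exists>\<Delta>::real. KL \<pi> (student \<nu> \<theta>') + ereal \<Delta> \<le> KL \<pi> (student \<nu> \<theta>)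
      \<and> (if \<theta>' = \<theta> then \<Delta> = 0 else \<Delta> > 0)"
  proof (cases "\<theta>' = \<theta>")
    case False
    have "?D + (\<nu> + ?d) * ln g < 0"
    proof (rule log_det_decrease[OF _ \<open>spd S'\<close> \<nu> g0 g_eq])
      show "spd (snd \<theta>)" using \<theta> by (auto simp: Params_def)
      show "(\<mu>', S') \<noteq> (fst \<theta>, snd \<theta>)" using False by (simp add: \<mu>'_def S'_def)
    qed
    then have "m / 2 * (?D + (\<nu> + ?d) * ln g) < 0" using m0 by (simp add: mult_pos_neg)
    moreover have "(\<nu> + ?d) / 2 * L \<le> (\<nu> + ?d) / 2 * (m * ln g)"
      using L \<nu> by (intro mult_left_mono) auto
    moreover have "m / 2 * (?D + (\<nu> + ?d) * ln g) = ?D / 2 * m + (\<nu> + ?d) / 2 * (m * ln g)"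
      by (simp add: field_simps)
    ultimately have "?D / 2 * m + (\<nu> + ?d) / 2 * L < 0" by linarith
    \<comment> \<open>The witness is the exact drop of the divergence, so the inequality holds with
      equality.\<close>
    then show ?thesis
      using False unfolding KL\<theta> KL\<theta>' by (intro exI[of _ "- (?D / 2 * m + (\<nu> + ?d) / 2 * L)"]) simp
  qed (auto intro!: exI[of _ 0] simp: zero_ereal_def[symmetric])
qed

theorem proposition7:
  fixes f :: "real ^ 'n \<Rightarrow> real"
    and w :: "real \<Rightarrow> real"
    and \<nu> :: real
    and \<theta> :: "nat \<Rightarrow> (real ^ 'n) \<times> (real ^ 'n ^ 'n)"
  assumes "\<nu> > 0"
    and "f \<in> borel_measurable lebesgue"
    and "\<And>u. u \<in> {0..1} \<Longrightarrow> w u \<ge> 0"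
    and "antimono_on {0..1} w"
    and "integral {0..1} w > 0"
    and "\<theta> 0 \<in> Params"
    and "\<And>k. \<theta> (Suc k) = ml_step \<nu> w f (\<theta> k)"
  shows "\<forall>k. \<exists>\<Delta>::real.
           KL (target w f (student \<nu> (\<theta> k))) (student \<nu> (\<theta> (Suc k))) + ereal \<Delta>
             \<le> KL (target w f (student \<nu> (\<theta> k))) (student \<nu> (\<theta> k))
           \<and> (if \<theta> (Suc k) = \<theta> k then \<Delta> = 0 else \<Delta> > 0)"
proof
  fix k
  have "\<theta> k \<in> Params"
  proof (induction k)
    case (Suc k)
    show ?case unfolding assms(7) by (rule ml_step_decrease(1)[OF assms(1-5) Suc])
  qed (rule assms(6))
  from ml_step_decrease(2)[OF assms(1-5) this] show "\<exists>\<Delta>::real.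
           KL (target w f (student \<nu> (\<theta> k))) (student \<nu> (\<theta> (Suc k))) + ereal \<Delta>
             \<le> KL (target w f (student \<nu> (\<theta> k))) (student \<nu> (\<theta> k))
           \<and> (if \<theta> (Suc k) = \<theta> k then \<Delta> = 0 else \<Delta> > 0)"
    unfolding assms(7) .
qed

end
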